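(* Let $H$ be a finite dimensional complex Hilbert space, and let $p$ be a real number in $(1,\infty)\setminus\{2\}$. Fix a real number $\gamma\geq 1$. If $a,b\in S(C_p(H))$ satisfy $\|a-\gamma e\|_p=\|b-\gamma e\|_p$ for every $e\in\mathcal{U}_{min}(H)$, then $a=b$.
   Context: $C_p(H)$ is the space of $p$-Schatten von Neumann operators on $H$ with norm $\|a\|_p=\left(\mathrm{tr}(|a|^p)\right)^{1/p}$, $|a|=(a^*a)^{1/2}$ (for finite dimensional $H$ this is all linear operators on $H$ with this norm). $S(C_p(H))$ is its unit sphere. $\mathcal{U}_{min}(H)$ is the set of minimal, i.e. rank one, partial isometries on $H$ (a partial isometry is an operator $e$ with $ee^*e=e$). *)

theory Defs
  imports "HOL-Analysis.Analysis"
begin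

class complex_vector = real_vector +
  fixes scaleC :: "complex \<Rightarrow> 'a \<Rightarrow> 'a"  (infixr \<open>*\<^sub>C\<close> 75)
  assumes scaleC_add_right: "c *\<^sub>C (x + y) = c *\<^sub>C x + c *\<^sub>C y"
    and scaleC_add_left: "(c + d) *\<^sub>C x = c *\<^sub>C x + d *\<^sub>C x"
    and scaleC_scaleC: "c *\<^sub>C d *\<^sub>C x = (c * d) *\<^sub>C x"
    and scaleC_one: "1 *\<^sub>C x = x"
    and scaleC_of_real: "complex_of_real r *\<^sub>C x = r *\<^sub>R x"

global_interpretation complex_vector: vector_space "scaleC :: complex \<Rightarrow> 'a \<Rightarrow> 'a::complex_vector"
  by unfold_locales (simp_all add: scaleC_add_right scaleC_add_left scaleC_scaleC scaleC_one)

text \<open>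
  Inner products are linear in the second and conjugate-linear in the first argument.
  Positive definiteness is contained in \<open>cinner_self\<close>, since \<open>norm\<close> is a norm.
\<close>

class complex_inner = complex_vector + real_normed_vector +
  fixes cinner :: "'a \<Rightarrow> 'a \<Rightarrow> complex"
  assumes cinner_commute: "cinner x y = cnj (cinner y x)"
    and cinner_add_right: "cinner x (y + z) = cinner x y + cinner x z"
    and cinner_scaleC_right: "cinner x (c *\<^sub>C y) = c * cinner x y"
    and cinner_self: "cinner x x = complex_of_real ((norm x)\<^sup>2)"

class complex_hilbert = complex_inner + complete_space

text \<open>
  The operator notions below are used only on finite-dimensional spaces, where the adjoint, the
  positive square root, the real powers and orthonormal bases in the algebraic sense all exist.
\<close>

abbreviation clinear :: "('h::complex_vector \<Rightarrow> 'h) \<Rightarrow> bool" where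
  "clinear \<equiv> Vector_Spaces.linear scaleC scaleC"

definition adjoint_op :: "('h::complex_hilbert \<Rightarrow> 'h) \<Rightarrow> 'h \<Rightarrow> 'h" where
  "adjoint_op a = (THE b. clinear b \<and> (\<forall>x y. cinner (a x) y = cinner x (b y)))"

definition positive_op :: "('h::complex_hilbert \<Rightarrow> 'h) \<Rightarrow> bool" where
  "positive_op t \<longleftrightarrow> clinear t \<and> (\<forall>x. cinner x (t x) \<in> \<real>\<^sub>\<ge>\<^sub>0)"

definition sqrt_op :: "('h::complex_hilbert \<Rightarrow> 'h) \<Rightarrow> 'h \<Rightarrow> 'h" where
  "sqrt_op t = (THE s. positive_op s \<and> s \<circ> s = t)"

definition abs_op :: "('h::complex_hilbert \<Rightarrow> 'h) \<Rightarrow> 'h \<Rightarrow> 'h" where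
  "abs_op a = sqrt_op (adjoint_op a \<circ> a)"

text \<open>
  Functional calculus for \<open>l \<mapsto> l powr p\<close> on positive operators: such an operator is
  diagonalisable, so its real power is the operator acting as \<open>l powr p\<close> on the eigenspace of
  each eigenvalue \<open>l\<close>. For \<open>p > 0\<close> this is consistent on the kernel, as \<open>0 powr p = 0\<close>.
\<close>

definition powr_op :: "('h::complex_hilbert \<Rightarrow> 'h) \<Rightarrow> real \<Rightarrow> 'h \<Rightarrow> 'h" where
  "powr_op t p = (THE s. clinear s \<and>
     (\<forall>l\<ge>0. \<forall>x. t x = l *\<^sub>R x \<longrightarrow> s x = (l powr p) *\<^sub>R x))"

definition orthonormal_basis :: "'h::complex_hilbert set \<Rightarrow> bool" where
  "orthonormal_basis B \<longleftrightarrow> finite B \<and> complex_vector.span B = UNIV \<and>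
     (\<forall>u\<in>B. \<forall>v\<in>B. cinner u v = (if u = v then 1 else 0))"

text \<open>The trace does not depend on the orthonormal basis that is chosen.\<close>

definition trace_op :: "('h::complex_hilbert \<Rightarrow> 'h) \<Rightarrow> complex" where
  "trace_op t = (\<Sum>v\<in>(SOME B. orthonormal_basis B). cinner v (t v))"

definition schatten_norm :: "real \<Rightarrow> ('h::complex_hilbert \<Rightarrow> 'h) \<Rightarrow> real" where
  "schatten_norm p a = Re (trace_op (powr_op (abs_op a) p)) powr (1 / p)"

text \<open>In finite dimension every linear operator belongs to the Schatten class.\<close>

definition schatten_sphere :: "real \<Rightarrow> ('h::complex_hilbert \<Rightarrow> 'h) set" where
  "schatten_sphere p = {a. clinear a \<and> schatten_norm p a = 1}"

definition partial_isometry :: "('h::complex_hilbert \<Rightarrow> 'h) \<Rightarrow> bool" where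
  "partial_isometry e \<longleftrightarrow> clinear e \<and> e \<circ> adjoint_op e \<circ> e = e"

definition min_partial_isometries :: "('h::complex_hilbert \<Rightarrow> 'h) set" where
  "min_partial_isometries = {e. partial_isometry e \<and> complex_vector.dim (range e) = 1}"

end

theory Submission imports Defs begin

text \<open>
  Write \<open>S\<close> for the operator norm of \<open>a\<close>. Over all rank-one partial isometries \<open>e\<close>, the maximum of
  \<open>\<parallel>a + \<gamma> e\<parallel>\<^sup>p\<close> is \<open>\<parallel>a\<parallel>\<^sup>p + (S + \<gamma>)\<^sup>p - S\<^sup>p\<close>, where \<open>\<parallel>\<cdot>\<parallel>\<close> is the Schatten norm, and it is attained exactly
  when \<open>e = u v\<^sup>*\<close> for a pair of singular vectors belonging to \<open>S\<close>. The bound comes from evaluating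
  \<open>a + \<gamma> e\<close> in its own singular bases: strict convexity of \<open>t \<mapsto> t\<^sup>p\<close> shows that the weight of \<open>e\<close> is
  best concentrated on one diagonal entry, and the \<open>p\<close>-th powers of the diagonal of \<open>a\<close> in any pair
  of orthonormal families sum to at most \<open>\<parallel>a\<parallel>\<^sup>p\<close>. Hence \<open>a\<close> and \<open>b\<close> share \<open>S\<close> and a top singular
  pair \<open>(u, v)\<close>. Subtracting \<open>S u v\<^sup>*\<close> from both operators lowers all relevant \<open>p\<close>-th powers by \<open>S\<^sup>p\<close>,
  so the argument can be repeated with perturbations orthogonal to \<open>u\<close> and \<open>v\<close>.
\<close>

subsection \<open>Complex inner products\<close>

lemma clinear_iff:
  "clinear f \<longleftrightarrow> (\<forall>x y. f (x + y) = f x + f y) \<and> (\<forall>c x. f (c *\<^sub>C x) = c *\<^sub>C f x)"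
  by (simp add: Vector_Spaces.linear_def module_hom_def module_hom_axioms_def
      complex_vector.vector_space_axioms complex_vector.module_axioms)

lemma clinear_add: "clinear f \<Longrightarrow> f (x + y) = f x + f y"
  by (simp add: clinear_iff)

lemma clinear_0: "clinear f \<Longrightarrow> f 0 = 0"
  using clinear_add[of f 0 0] by simp

lemma clinear_diff: "clinear f \<Longrightarrow> f (x - y) = f x - f y"
  using clinear_add[of f "x - y" y] by (simp add: algebra_simps)

lemma clinear_scaleC: "clinear f \<Longrightarrow> f (c *\<^sub>C x) = c *\<^sub>C f x"
  by (simp add: clinear_iff)

lemma clinear_sum: "clinear f \<Longrightarrow> f (sum g S) = (\<Sum>i\<in>S. f (g i))"
  by (induction S rule: infinite_finite_induct) (simp_all add: clinear_0 clinear_add)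

lemmas clinear_simps = clinear_0 clinear_add clinear_diff clinear_scaleC clinear_sum

lemma clinear_scaleR: "clinear f \<Longrightarrow> f (r *\<^sub>R x) = r *\<^sub>R f x"
  by (simp add: clinear_iff flip: scaleC_of_real)

lemma cinner_scaleC_left: "cinner (c *\<^sub>C x) y = cnj c * cinner x y"
  for x y :: "'a::complex_inner"
  by (metis cinner_commute cinner_scaleC_right complex_cnj_mult)

lemma cinner_scaleR_right: "cinner x (r *\<^sub>R y) = of_real r * cinner x y"
  for x y :: "'a::complex_inner"
  by (simp add: cinner_scaleC_right flip: scaleC_of_real)

lemma cinner_scaleR_left: "cinner (r *\<^sub>R x) y = of_real r * cinner x y"
  for x y :: "'a::complex_inner"
  by (simp add: cinner_scaleC_left flip: scaleC_of_real)

lemma cinner_add_left: "cinner (x + y) z = cinner x z + cinner y z"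
  for x y z :: "'a::complex_inner"
  by (metis cinner_commute cinner_add_right complex_cnj_add)

lemma cinner_0_right [simp]: "cinner x 0 = 0" for x :: "'a::complex_inner"
  using cinner_scaleR_right[of x 0 0] by simp

lemma cinner_0_left [simp]: "cinner 0 x = 0" for x :: "'a::complex_inner"
  using cinner_scaleR_left[of 0 0 x] by simp

lemma cinner_minus_right [simp]: "cinner x (- y) = - cinner x y" for x y :: "'a::complex_inner"
  using cinner_scaleR_right[of x "-1" y] by simp

lemma cinner_minus_left [simp]: "cinner (- x) y = - cinner x y" for x y :: "'a::complex_inner"
  using cinner_scaleR_left[of "-1" x y] by simp

lemma cinner_eq_zero_commute: "cinner x y = 0 \<longleftrightarrow> cinner y x = 0"
  for x y :: "'a::complex_inner"
  by (metis cinner_commute complex_cnj_zero)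

lemma cinner_diff_right: "cinner x (y - z) = cinner x y - cinner x z"
  for x y z :: "'a::complex_inner"
  using cinner_add_right[of x y "- z"] by simp

lemma cinner_diff_left: "cinner (x - y) z = cinner x z - cinner y z"
  for x y z :: "'a::complex_inner"
  using cinner_add_left[of x "- y" z] by simp

lemma cinner_sum_right: "cinner x (sum f S) = (\<Sum>i\<in>S. cinner x (f i))"
  for x :: "'a::complex_inner"
  by (induction S rule: infinite_finite_induct) (auto simp: cinner_add_right)

lemma cinner_sum_left: "cinner (sum f S) x = (\<Sum>i\<in>S. cinner (f i) x)"
  for x :: "'a::complex_inner"
  by (induction S rule: infinite_finite_induct) (auto simp: cinner_add_left)

lemmas cinner_simps = cinner_add_left cinner_add_right cinner_diff_left cinner_diff_right
  cinner_scaleC_left cinner_scaleC_right cinner_scaleR_left cinner_scaleR_right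
  cinner_sum_left cinner_sum_right

lemma cinner_self_eq_zero [simp]: "cinner x x = 0 \<longleftrightarrow> x = 0" for x :: "'a::complex_inner"
  by (simp add: cinner_self)

lemma norm_sq_cinner: "(norm x)\<^sup>2 = Re (cinner x x)" for x :: "'a::complex_inner"
  by (simp add: cinner_self)

lemma cinner_self_unit [simp]: "norm x = 1 \<Longrightarrow> cinner x x = 1" for x :: "'a::complex_inner"
  by (simp add: cinner_self)

lemma Re_cinner_commute: "Re (cinner x y) = Re (cinner y x)" for x :: "'a::complex_inner"
  by (metis cinner_commute cnj.sel(1))

lemma norm_add_sq: "(norm (x + y))\<^sup>2 = (norm x)\<^sup>2 + 2 * Re (cinner x y) + (norm y)\<^sup>2"
  for x y :: "'a::complex_inner"
  by (simp add: norm_sq_cinner cinner_simps Re_cinner_commute[of y x])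

lemma norm_diff_sq: "(norm (x - y))\<^sup>2 = (norm x)\<^sup>2 - 2 * Re (cinner x y) + (norm y)\<^sup>2"
  for x y :: "'a::complex_inner"
  using norm_add_sq[of x "- y"] by simp

lemma norm_scaleC: "norm (c *\<^sub>C x) = cmod c * norm x" for x :: "'a::complex_inner"
proof -
  have "(norm (c *\<^sub>C x))\<^sup>2 = Re (cnj c * c * cinner x x)"
    by (simp only: norm_sq_cinner cinner_scaleC_left cinner_scaleC_right mult.assoc
        mult.left_commute)
  also have "cnj c * c = of_real ((cmod c)\<^sup>2)"
    using complex_norm_square[of c] by (simp add: mult.commute)
  also have "Re (of_real ((cmod c)\<^sup>2) * cinner x x) = (cmod c * norm x)\<^sup>2"
    by (simp add: cinner_self power_mult_distrib flip: of_real_power)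
  finally show ?thesis by simp
qed

lemma Cauchy_Schwarz: "cmod (cinner x y) \<le> norm x * norm y" for x y :: "'a::complex_inner"
proof (cases "x = 0")
  case False
  define c where "c = cinner x y / of_real ((norm x)\<^sup>2)"
  have nx: "norm x > 0" using False by simp
  have "0 \<le> (norm (y - c *\<^sub>C x))\<^sup>2" by simp
  also have "\<dots> = (norm y)\<^sup>2 - 2 * Re (c * cinner y x) + (cmod c * norm x)\<^sup>2"
    by (simp add: norm_diff_sq cinner_simps norm_scaleC)
  also have "c * cinner y x = of_real ((cmod (cinner x y))\<^sup>2 / (norm x)\<^sup>2)"
    using complex_norm_square[of "cinner x y"] by (simp add: c_def cinner_commute[of y x])
  also have "(cmod c * norm x)\<^sup>2 = (cmod (cinner x y))\<^sup>2 / (norm x)\<^sup>2"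
    using nx by (simp add: c_def norm_divide norm_mult power2_eq_square)
  finally have "(cmod (cinner x y))\<^sup>2 / (norm x)\<^sup>2 \<le> (norm y)\<^sup>2" by simp
  then have "(cmod (cinner x y))\<^sup>2 \<le> (norm x * norm y)\<^sup>2"
    using nx by (simp add: field_simps)
  then show ?thesis by (rule power2_le_imp_le) simp
qed simp

lemma cmod_cinner_le_1: "norm x = 1 \<Longrightarrow> norm y = 1 \<Longrightarrow> cmod (cinner x y) \<le> 1"
  for x y :: "'a::complex_inner"
  using Cauchy_Schwarz[of x y] by simp

lemma cinner_extensionality:
  "(\<And>x. cinner x y = cinner x z) \<Longrightarrow> y = z" for y z :: "'a::complex_inner"
  by (metis cinner_diff_right cinner_self_eq_zero eq_iff_diff_eq_0)

section \<open>Orthonormal families and Bessel's inequality\<close>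

definition orthonormal :: "'i set \<Rightarrow> ('i \<Rightarrow> 'h::complex_inner) \<Rightarrow> bool" where
  "orthonormal I u \<longleftrightarrow> (\<forall>i\<in>I. \<forall>j\<in>I. cinner (u i) (u j) = (if i = j then 1 else 0))"

lemma orthonormalD:
  "orthonormal I u \<Longrightarrow> i \<in> I \<Longrightarrow> j \<in> I \<Longrightarrow> cinner (u i) (u j) = (if i = j then 1 else 0)"
  by (simp add: orthonormal_def)

lemma orthonormal_norm: "orthonormal I u \<Longrightarrow> i \<in> I \<Longrightarrow> norm (u i) = 1"
  by (rule power2_eq_imp_eq) (simp_all add: norm_sq_cinner orthonormalD)

lemma orthonormal_subset: "orthonormal I u \<Longrightarrow> J \<subseteq> I \<Longrightarrow> orthonormal J u"
  unfolding orthonormal_def by blast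

lemma orthonormal_insert:
  assumes "orthonormal I u" "norm (u k) = 1" "\<And>i. i \<in> I \<Longrightarrow> i \<noteq> k \<Longrightarrow> cinner (u i) (u k) = 0"
  shows "orthonormal (insert k I) u"
  using assms cinner_eq_zero_commute[THEN iffD1, OF assms(3)] unfolding orthonormal_def
  by (auto simp: assms(2))

lemma orthonormal_expansion:
  assumes "orthonormal I u" "finite I" "j \<in> I"
  shows "cinner (u j) (\<Sum>i\<in>I. c i *\<^sub>C u i) = c j"
  using assms by (simp add: cinner_simps orthonormalD if_distrib cong: if_cong)

lemma Bessel_residual:
  assumes "orthonormal I u" "finite I"
  shows "(norm (x - (\<Sum>i\<in>I. cinner (u i) x *\<^sub>C u i)))\<^sup>2
    = (norm x)\<^sup>2 - (\<Sum>i\<in>I. (cmod (cinner (u i) x))\<^sup>2)"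
proof -
  let ?y = "\<Sum>i\<in>I. cinner (u i) x *\<^sub>C u i"
  have sq: "cnj (cinner (u i) x) * cinner (u i) x = of_real ((cmod (cinner (u i) x))\<^sup>2)" for i
    using complex_norm_square[of "cinner (u i) x"] by (simp add: mult.commute)
  have "cinner x ?y = (\<Sum>i\<in>I. cnj (cinner (u i) x) * cinner (u i) x)"
    unfolding cinner_sum_right cinner_scaleC_right
    by (intro sum.cong refl) (subst (2) cinner_commute, rule mult.commute)
  then have 1: "cinner x ?y = of_real (\<Sum>i\<in>I. (cmod (cinner (u i) x))\<^sup>2)"
    by (simp only: sq of_real_sum)
  have "cinner ?y ?y = (\<Sum>i\<in>I. cnj (cinner (u i) x) * cinner (u i) ?y)"
    by (simp only: cinner_sum_left cinner_scaleC_left)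
  also have "\<dots> = (\<Sum>i\<in>I. cnj (cinner (u i) x) * cinner (u i) x)"
    by (intro sum.cong refl) (simp add: orthonormal_expansion[OF assms])
  also have "\<dots> = of_real (\<Sum>i\<in>I. (cmod (cinner (u i) x))\<^sup>2)"
    by (simp only: sq of_real_sum)
  finally have 2: "cinner ?y ?y = of_real (\<Sum>i\<in>I. (cmod (cinner (u i) x))\<^sup>2)" .
  show ?thesis
    unfolding norm_diff_sq 1 norm_sq_cinner[of ?y] 2 by simp
qed

lemma Bessel:
  assumes "orthonormal I u" "finite I"
  shows "(\<Sum>i\<in>I. (cmod (cinner (u i) x))\<^sup>2) \<le> (norm x)\<^sup>2"
  using Bessel_residual[OF assms, of x] by (smt (verit) zero_le_power2)

lemma orthonormal_residual:
  assumes "orthonormal I u" "finite I" "j \<in> I"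
  shows "cinner (u j) (x - (\<Sum>i\<in>I. cinner (u i) x *\<^sub>C u i)) = 0"
  by (simp add: cinner_diff_right orthonormal_expansion[OF assms])

definition rank_one :: "'h::complex_inner \<Rightarrow> 'h \<Rightarrow> 'h \<Rightarrow> 'h" where
  "rank_one u v x = cinner v x *\<^sub>C u"

lemma clinear_rank_one [simp]: "clinear (rank_one u v)"
  by (auto simp: clinear_iff rank_one_def cinner_simps scaleC_add_left scaleC_scaleC)

lemma clinear_scaleR_rank_one [simp]: "clinear (\<lambda>x. r *\<^sub>R rank_one u v x)"
  by (auto simp: clinear_iff rank_one_def cinner_simps scaleC_add_left scaleC_scaleC
     scaleC_add_right mult.left_commute distrib_left simp flip: scaleC_of_real)

lemma clinear_add_op:
  fixes f g :: "'h::complex_vector \<Rightarrow> 'h"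
  shows "clinear f \<Longrightarrow> clinear g \<Longrightarrow> clinear (\<lambda>x. f x + g x)"
  by (auto simp: clinear_iff scaleC_add_right)

lemma clinear_diff_op:
  fixes f g :: "'h::complex_vector \<Rightarrow> 'h"
  shows "clinear f \<Longrightarrow> clinear g \<Longrightarrow> clinear (\<lambda>x. f x - g x)"
  by (auto simp: clinear_iff complex_vector.scale_right_diff_distrib)

subsection \<open>Convexity of powers\<close>

lemma powr_mean_value:
  fixes x y p :: real
  assumes "1 < p" "0 \<le> x" "x < y"
  obtains z where "x < z" "z < y" "y powr p - x powr p = (y - x) * (p * z powr (p - 1))"
proof -
  have "\<exists>l z. x < z \<and> z < y \<and> ((\<lambda>x. x powr p) has_real_derivative l) (at z) \<and>
      y powr p - x powr p = (y - x) * l"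
  proof (rule MVT)
    show "continuous_on {x..y} (\<lambda>x. x powr p)"
      using assms by (intro continuous_on_powr' continuous_intros) auto
    show "(\<lambda>x. x powr p) differentiable (at z)" if "x < z" "z < y" for z
      using has_real_derivative_powr[of z p] that assms(2)
      unfolding real_differentiable_def by force
  qed (use assms in auto)
  then obtain l z where *: "x < z" "z < y" "((\<lambda>x. x powr p) has_real_derivative l) (at z)"
    "y powr p - x powr p = (y - x) * l" by blast
  moreover have "l = p * z powr (p - 1)"
    using DERIV_unique[OF *(3) has_real_derivative_powr[of z p]] * assms by simp
  ultimately show ?thesis using that by blast
qed

text \<open>The mean slope over the first piece, of length \<open>h * t\<close>, is smaller than
  over the rest, because \<open>z powr (p - 1)\<close> is strictly increasing. The increment form
  matches the gain of a perturbation with weight \<open>t\<close>.\<close>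

lemma powr_strict_convex:
  fixes p x h t :: real
  assumes "1 < p" "0 \<le> x" "0 < h" "0 < t" "t < 1"
  shows "(x + h * t) powr p < x powr p + t * ((x + h) powr p - x powr p)"
proof -
  have ht: "0 < h * t" "h * t < h" using assms by auto
  obtain z where z: "z < x + h * t" "x < z"
    "(x + h * t) powr p - x powr p = (h * t) * (p * z powr (p - 1))"
    using powr_mean_value[of p x "x + h * t"] assms ht by auto
  obtain w where w: "x + h * t < w"
    "(x + h) powr p - (x + h * t) powr p = (h - h * t) * (p * w powr (p - 1))"
    using powr_mean_value[of p "x + h * t" "x + h"] assms ht by auto
  have "z powr (p - 1) < w powr (p - 1)"
    using assms z w by (intro powr_less_mono2) auto
  then have "(h * t * (1 - t) * p) * z powr (p - 1) < (h * t * (1 - t) * p) * w powr (p - 1)"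
    using assms by simp
  then have "(1 - t) * ((x + h * t) powr p - x powr p) < t * ((x + h) powr p - (x + h * t) powr p)"
    unfolding z w by (simp add: algebra_simps)
  then show ?thesis by (simp add: algebra_simps)
qed

text \<open>The derivative of the increment with respect to its base point is a positive multiple of
  a difference of (p-1)-th powers. Hence a larger top singular value gains strictly more from the
  same perturbation, so the gain determines it.\<close>

lemma powr_increment_strict_mono:
  fixes p x y h :: real
  assumes "1 < p" "0 \<le> x" "x < y" "0 < h"
  shows "(x + h) powr p - x powr p < (y + h) powr p - y powr p"
proof (rule DERIV_pos_imp_increasing_open[of x y "\<lambda>z. (z + h) powr p - z powr p"])
  show "\<exists>d. ((\<lambda>z. (z + h) powr p - z powr p) has_real_derivative d) (at z) \<and> d > 0"
    if "x < z" "z < y" for z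
  proof (intro exI conjI)
    show "((\<lambda>z. (z + h) powr p - z powr p) has_real_derivative
        p * (z + h) powr (p - 1) - p * z powr (p - 1)) (at z)"
      using that assms by (auto intro!: derivative_eq_intros)
    show "p * (z + h) powr (p - 1) - p * z powr (p - 1) > 0"
      using that assms by (simp add: powr_less_mono2)
  qed
  show "continuous_on {x..y} (\<lambda>z. (z + h) powr p - z powr p)"
    using assms by (intro continuous_intros continuous_on_powr') auto
qed fact

lemma powr_tangent:
  fixes p m s :: real
  assumes "1 < p" "0 < m" "0 \<le> s"
  shows "m powr p + p * m powr (p - 1) * (s - m) \<le> s powr p"
proof (cases s m rule: linorder_cases)
  case less
  obtain z where z: "s < z" "z < m" "m powr p - s powr p = (m - s) * (p * z powr (p - 1))"
    by (rule powr_mean_value[OF assms(1,3) less])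
  have "(m - s) * (p * z powr (p - 1)) \<le> (m - s) * (p * m powr (p - 1))"
    using z less assms by (intro mult_left_mono powr_mono2) auto
  moreover have "p * m powr (p - 1) * (s - m) = - ((m - s) * (p * m powr (p - 1)))"
    by (simp add: algebra_simps)
  ultimately show ?thesis using z(3) by linarith
next
  case greater
  obtain z where z: "m < z" "z < s" "s powr p - m powr p = (s - m) * (p * z powr (p - 1))"
    by (rule powr_mean_value[OF assms(1) _ greater]) (use assms in simp)
  have "(s - m) * (p * m powr (p - 1)) \<le> (s - m) * (p * z powr (p - 1))"
    using z greater assms by (intro mult_left_mono powr_mono2) auto
  moreover have "p * m powr (p - 1) * (s - m) = (s - m) * (p * m powr (p - 1))"
    by (simp add: algebra_simps)
  ultimately show ?thesis using z(3) by linarith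
qed simp

text \<open>Jensen's inequality in which the missing mass sits at 0, where the power vanishes.
  Averaging the tangent inequality at the weighted sum \<open>m\<close> gives
  \<open>m powr p\<close> plus the surplus \<open>(p - 1) * (1 - sum d I) * m powr p\<close>, which
  is nonnegative.\<close>

lemma powr_Jensen_substochastic:
  fixes p :: real
  assumes "1 < p" "finite I" "\<And>i. i \<in> I \<Longrightarrow> 0 \<le> d i" "\<And>i. i \<in> I \<Longrightarrow> 0 \<le> s i" "sum d I \<le> 1"
  shows "(\<Sum>i\<in>I. d i * s i) powr p \<le> (\<Sum>i\<in>I. d i * s i powr p)"
proof -
  define m where "m = (\<Sum>i\<in>I. d i * s i)"
  have "0 \<le> m" unfolding m_def using assms by (intro sum_nonneg) auto
  show ?thesis
  proof (cases "m = 0")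
    case True
    then show ?thesis using assms by (auto simp flip: m_def intro!: sum_nonneg)
  next
    case False
    with \<open>0 \<le> m\<close> have m: "0 < m" by simp
    have mp: "m powr p = m powr (p - 1) * m"
      using m by (simp add: powr_diff)
    have sums: "(\<Sum>i\<in>I. d i * (K + L * (s i - m))) = K * sum d I + L * m - L * m * sum d I" for K L
    proof -
      have "(\<Sum>i\<in>I. d i * (K + L * (s i - m))) = (\<Sum>i\<in>I. K * d i + L * (d i * s i) - L * m * d i)"
        by (intro sum.cong refl) (simp add: algebra_simps)
      also have "\<dots> = K * sum d I + L * (\<Sum>i\<in>I. d i * s i) - L * m * sum d I"
        by (simp only: sum.distrib sum_subtractf sum_distrib_left)
      finally show ?thesis by (simp only: m_def)
    qed
    have "m powr p \<le> m powr p + m powr p * ((p - 1) * (1 - sum d I))"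
      using assms by simp
    also have "\<dots> = sum d I * m powr p + p * m powr (p - 1) * (m - m * sum d I)"
      unfolding mp by (simp add: algebra_simps)
    also have "\<dots> = (\<Sum>i\<in>I. d i * (m powr p + p * m powr (p - 1) * (s i - m)))"
      unfolding sums by (simp add: algebra_simps)
    also have "\<dots> \<le> (\<Sum>i\<in>I. d i * s i powr p)"
      using assms m by (intro sum_mono mult_left_mono powr_tangent) auto
    finally show ?thesis by (simp add: m_def)
  qed
qed

text \<open>The extreme value \<open>c = S + h\<close> is excluded, as equality holds for \<open>A = S\<close>, \<open>t = 1\<close>.\<close>

lemma powr_perturbation_less:
  fixes p A S h t c :: real
  assumes p: "1 < p" and A: "0 \<le> A" "A \<le> S" and h: "0 < h" and t: "0 < t" "t \<le> 1"
    and c: "0 \<le> c" "c \<le> A + h * t" "c < S + h"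
  shows "c powr p < A powr p + t * ((S + h) powr p - S powr p)"
proof (cases "t < 1")
  case True
  have inc: "(A + h) powr p - A powr p \<le> (S + h) powr p - S powr p"
  proof (cases "A = S")
    case False
    then show ?thesis
      using powr_increment_strict_mono[OF p A(1) _ h, of S] A(2) by linarith
  qed simp
  have "c powr p \<le> (A + h * t) powr p"
    using p c by (intro powr_mono2) auto
  also have "\<dots> < A powr p + t * ((A + h) powr p - A powr p)"
    by (rule powr_strict_convex[OF p A(1) h t(1) True])
  also have "\<dots> \<le> A powr p + t * ((S + h) powr p - S powr p)"
    using mult_left_mono[OF inc, of t] t by linarith
  finally show ?thesis .
next
  case False
  then have [simp]: "t = 1" using t by simp
  show ?thesis
  proof (cases "A = S")
    case True
    have "c powr p < (S + h) powr p"
      using p c by (intro powr_less_mono2) auto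
    then show ?thesis using True by simp
  next
    case False
    have "c powr p \<le> (A + h) powr p"
      using p c by (intro powr_mono2) auto
    then show ?thesis
      using powr_increment_strict_mono[OF p A(1) _ h, of S] A(2) False by simp
  qed
qed

lemma powr_perturbation_le:
  fixes p A S h t c :: real
  assumes "1 < p" "0 \<le> A" "A \<le> S" "0 < h" "0 \<le> t" "t \<le> 1" "0 \<le> c" "c \<le> A + h * t"
  shows "c powr p \<le> A powr p + t * ((S + h) powr p - S powr p)"
proof (cases "t = 0")
  case True
  then show ?thesis using assms by (simp add: powr_mono2)
next
  case False
  have ht: "h * t \<le> h"
    using mult_left_mono[OF assms(6), of h] assms(4) by simp
  show ?thesis
  proof (cases "c < S + h")
    case True
    then show ?thesis
      using powr_perturbation_less[of p A S h t c] assms False by simp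
  next
    case False
    \<comment> \<open>Only the extreme value remains: reaching \<open>S + h\<close> forces
      \<open>A = S\<close> and full weight, and there the estimate is an equality.\<close>
    then have "A = S" "h * t = h" "c = S + h" using ht assms by linarith+
    then show ?thesis using assms(4) by simp
  qed
qed

subsection \<open>Top singular pairs and the singular value decomposition\<close>

definition top_pair :: "('h::complex_inner \<Rightarrow> 'h) \<Rightarrow> real \<Rightarrow> 'h \<Rightarrow> 'h \<Rightarrow> bool" where
  "top_pair a S u v \<longleftrightarrow> 0 < S \<and> norm u = 1 \<and> norm v = 1 \<and> a v = S *\<^sub>R u \<and>
    (\<forall>x. norm (a x) \<le> S * norm x)"

definition deflate :: "('h::complex_inner \<Rightarrow> 'h) \<Rightarrow> real \<Rightarrow> 'h \<Rightarrow> 'h \<Rightarrow> 'h \<Rightarrow> 'h" where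
  "deflate a S u v x = a x - S *\<^sub>R rank_one u v x"

lemma clinear_deflate [simp]: "clinear a \<Longrightarrow> clinear (deflate a S u v)"
  unfolding deflate_def by (intro clinear_diff_op clinear_scaleR_rank_one)

text \<open>This is the dual relation saying that the adjoint of \<open>a\<close> sends
  \<open>u\<close> to \<open>S v\<close>, in weak form. The quadratic form
  \<open>(S * norm x)\<^sup>2 - (norm (a x))\<^sup>2\<close> is nonnegative and vanishes at
  \<open>v\<close>, so its first variation at \<open>v\<close> vanishes in every direction.\<close>

lemma top_pair_cinner:
  assumes a: "clinear a" and "top_pair a S u v"
  shows "cinner u (a x) = of_real S * cinner v x"
proof -
  have S: "0 < S" and uv: "norm u = 1" "norm v = 1" "a v = S *\<^sub>R u"
    and le: "\<And>x. norm (a x) \<le> S * norm x"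
    using assms by (auto simp: top_pair_def)
  define d where "d = cinner (a v) (a x) - of_real (S\<^sup>2) * cinner v x"
  define K where "K = (S * norm x)\<^sup>2"
  \<comment> \<open>The perturbation \<open>v + c x\<close> compares a term linear in
    \<open>c\<close>, with coefficient \<open>d\<close>, to a quadratic one.\<close>
  have ineq: "2 * Re (c * d) \<le> (cmod c)\<^sup>2 * K" for c
  proof -
    have "(norm (a (v + c *\<^sub>C x)))\<^sup>2 \<le> (S * norm (v + c *\<^sub>C x))\<^sup>2"
      by (intro power_mono le) simp
    then have "S\<^sup>2 + 2 * Re (c * cinner (a v) (a x)) + (cmod c * norm (a x))\<^sup>2
        \<le> S\<^sup>2 * (1 + 2 * Re (c * cinner v x) + (cmod c * norm x)\<^sup>2)"
      unfolding power_mult_distrib[of S] norm_add_sq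
      using S by (simp add: clinear_simps[OF a] norm_add_sq cinner_scaleC_right norm_scaleC uv)
    moreover have "0 \<le> (cmod c * norm (a x))\<^sup>2" by simp
    moreover have "2 * Re (c * d) = 2 * Re (c * cinner (a v) (a x)) - S\<^sup>2 * (2 * Re (c * cinner v x))"
      unfolding d_def by (simp add: algebra_simps)
    moreover have "(cmod c)\<^sup>2 * K = S\<^sup>2 * (cmod c * norm x)\<^sup>2"
      by (simp add: K_def power_mult_distrib)
    ultimately show ?thesis unfolding distrib_left by linarith
  qed
  have "d = 0"
  proof (rule ccontr)
    assume "d \<noteq> 0"
    then have dp: "(cmod d)\<^sup>2 > 0" by simp
    have K: "K \<ge> 0" by (simp add: K_def)
    \<comment> \<open>For \<open>c = t * cnj d\<close> the linear side is
      \<open>2 * t * (cmod d)\<^sup>2\<close>, while \<open>t * K < 1\<close> keeps the quadratic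
      side below half of that.\<close>
    define t where "t = 1 / (K + 1)"
    have t: "t > 0" "t * K < 1" using K by (auto simp: t_def field_simps)
    have "cnj d * d = of_real ((cmod d)\<^sup>2)"
      using complex_norm_square[of d] by (simp add: mult.commute)
    then have "Re (of_real t * cnj d * d) = t * (cmod d)\<^sup>2"
      by (simp add: mult.assoc flip: of_real_power)
    moreover have "(cmod (of_real t * cnj d))\<^sup>2 * K = (t * (cmod d)\<^sup>2) * (t * K)"
      by (simp add: norm_mult power_mult_distrib power2_eq_square)
    ultimately have "2 * (t * (cmod d)\<^sup>2) \<le> (t * (cmod d)\<^sup>2) * (t * K)"
      using ineq[of "of_real t * cnj d"] by linarith
    moreover have "(t * (cmod d)\<^sup>2) * (t * K) < (t * (cmod d)\<^sup>2) * 1"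
      using t dp by (intro mult_strict_left_mono) auto
    moreover have "0 < t * (cmod d)\<^sup>2" using t dp by simp
    ultimately show False by linarith
  qed
  then have "of_real S * cinner u (a x) = of_real S * (of_real S * cinner v x)"
    by (simp add: d_def uv cinner_scaleR_left power2_eq_square mult.assoc)
  then show ?thesis using S by simp
qed

lemma top_pair_kernel:
  assumes "clinear a" "top_pair a S u v" "a x = 0"
  shows "cinner v x = 0"
  using top_pair_cinner[OF assms(1,2), of x] assms by (auto simp: top_pair_def)

lemma deflate_top:
  assumes "clinear a" "top_pair a S u v"
  shows "deflate a S u v v = 0" "cinner u (deflate a S u v x) = 0"
  using top_pair_cinner[OF assms, of x] assms(2)
  by (auto simp: deflate_def rank_one_def top_pair_def cinner_simps scaleC_one)

text \<open>The right singular vectors serve as their own index set.\<close>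

definition svd :: "('h::complex_inner \<Rightarrow> 'h) \<Rightarrow> 'h set \<Rightarrow> ('h \<Rightarrow> real) \<Rightarrow> ('h \<Rightarrow> 'h) \<Rightarrow> bool" where
  "svd a V s u \<longleftrightarrow> finite V \<and> orthonormal V (\<lambda>v. v) \<and> orthonormal V u \<and> (\<forall>v\<in>V. 0 < s v) \<and>
    a = (\<lambda>x. \<Sum>v\<in>V. (of_real (s v) * cinner v x) *\<^sub>C u v)"

context
  fixes a V s u
  assumes svd: "svd a V s u"
begin

lemma svd_finite: "finite V" and svd_right: "orthonormal V (\<lambda>v. v)"
  and svd_left: "orthonormal V u" and svd_pos: "v \<in> V \<Longrightarrow> 0 < s v"
  using svd by (auto simp: svd_def)

lemma svd_apply: "a x = (\<Sum>v\<in>V. (of_real (s v) * cinner v x) *\<^sub>C u v)"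
  using svd by (auto simp: svd_def)

lemma svd_vector:
  assumes "v \<in> V"
  shows "a v = s v *\<^sub>R u v"
proof -
  have "a v = (\<Sum>w\<in>V. if w = v then s v *\<^sub>R u v else 0)"
    unfolding svd_apply
    by (intro sum.cong refl) (auto simp: orthonormalD[OF svd_right] assms scaleC_of_real)
  then show ?thesis using assms svd_finite by simp
qed

lemma svd_cinner: "v \<in> V \<Longrightarrow> cinner (u v) (a x) = of_real (s v) * cinner v x"
  unfolding svd_apply by (rule orthonormal_expansion[OF svd_left svd_finite])

end

text \<open>The two vanishing conditions make \<open>v0\<close> orthogonal to all right singular
  vectors and \<open>u0\<close> orthogonal to all left ones, because the singular values in a
  decomposition are positive. No order between \<open>S\<close> and the old values is imposed, so
  the new value may be any positive number.\<close>

lemma svd_insert: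
  assumes svd: "svd a V s u" and uv: "norm u0 = 1" "norm v0 = 1"
    and v0: "a v0 = 0" and u0: "\<And>x. cinner u0 (a x) = 0" and S: "0 < S"
  shows "v0 \<notin> V \<and>
    svd (\<lambda>x. a x + S *\<^sub>R rank_one u0 v0 x) (insert v0 V) (s(v0 := S)) (u(v0 := u0))"
proof -
  have orth: "cinner v v0 = 0" "cinner (u v) u0 = 0" if "v \<in> V" for v
  proof -
    show "cinner v v0 = 0"
      using svd_cinner[OF svd that, of v0] svd_pos[OF svd that] v0 by simp
    have "of_real (s v) * cinner u0 (u v) = 0"
      using u0[of v] by (simp add: svd_vector[OF svd that] cinner_scaleR_right)
    then show "cinner (u v) u0 = 0"
      using svd_pos[OF svd that] by (simp add: cinner_eq_zero_commute)
  qed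
  have notin: "v0 \<notin> V" using orth(1)[of v0] uv(2) by auto
  have "orthonormal V (u(v0 := u0))"
    using svd_left[OF svd] notin by (auto simp: orthonormal_def)
  then have "orthonormal (insert v0 V) (u(v0 := u0))"
    by (rule orthonormal_insert) (use uv orth in auto)
  moreover have "orthonormal (insert v0 V) (\<lambda>v. v)"
    by (rule orthonormal_insert[OF svd_right[OF svd]]) (use uv orth in auto)
  moreover have "a x + S *\<^sub>R rank_one u0 v0 x =
      (\<Sum>v\<in>insert v0 V. (of_real ((s(v0 := S)) v) * cinner v x) *\<^sub>C (u(v0 := u0)) v)" for x
  proof -
    have "(\<Sum>v\<in>V. (of_real ((s(v0 := S)) v) * cinner v x) *\<^sub>C (u(v0 := u0)) v) = a x"
      unfolding svd_apply[OF svd] using notin by (intro sum.cong) auto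
    then show ?thesis
      using notin svd_finite[OF svd]
      by (simp add: rank_one_def add.commute flip: scaleC_of_real)
  qed
  ultimately show ?thesis
    using notin svd_finite[OF svd] svd_pos[OF svd] S by (auto simp: svd_def fun_eq_iff)
qed

section \<open>Orthonormal bases and compactness in finite dimension\<close>

lemma orthonormal_independent:
  fixes E :: "'h::complex_inner set"
  assumes "orthonormal E (\<lambda>v. v)"
  shows "complex_vector.independent E"
proof
  assume "complex_vector.dependent E"
  then obtain T c v where T: "finite T" "T \<subseteq> E" "(\<Sum>v\<in>T. c v *\<^sub>C v) = 0" "v \<in> T" "c v \<noteq> 0"
    unfolding complex_vector.dependent_explicit by blast
  have "cinner v (\<Sum>w\<in>T. c w *\<^sub>C w) = c v"
    using orthonormal_expansion[OF orthonormal_subset[OF assms T(2)] T(1,4)] .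
  then show False using T by simp
qed

locale finite_dim_hilbert =
  fixes B0 :: "'h::complex_hilbert set"
  assumes finite_B0: "finite B0" and span_B0: "complex_vector.span B0 = UNIV"
begin

lemma orthonormal_card_le:
  fixes E :: "'h set"
  assumes "orthonormal E (\<lambda>v. v)"
  shows "finite E" "card E \<le> card B0"
  using complex_vector.independent_span_bound[OF finite_B0 orthonormal_independent[OF assms]]
  by (auto simp: span_B0)

lemma ex_orthonormal_basis: "\<exists>B::'h set. orthonormal_basis B"
proof -
  let ?P = "\<lambda>n. \<exists>E::'h set. orthonormal E (\<lambda>v. v) \<and> card E = n"
  have "?P 0" by (rule exI[of _ "{}"]) (simp add: orthonormal_def)
  \<comment> \<open>\<open>n\<close> is the largest size of an orthonormal set, which exists since
    sizes are bounded by \<open>card B0\<close>. A set of this size spans, as a nonzero normalised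
    residual would enlarge it.\<close>
  then obtain n where n: "?P n" "\<And>m. ?P m \<Longrightarrow> m \<le> n"
    using Greatest_le_nat[of ?P _ "card B0"] GreatestI_nat[of ?P 0 "card B0"] orthonormal_card_le
    by blast
  obtain E :: "'h set" where E: "orthonormal E (\<lambda>v. v)" "card E = n" using n(1) by blast
  note fin = orthonormal_card_le(1)[OF E(1)]
  have "x \<in> complex_vector.span E" for x
  proof -
    let ?y = "\<Sum>v\<in>E. cinner v x *\<^sub>C v"
    have y: "?y \<in> complex_vector.span E"
      by (intro complex_vector.span_sum complex_vector.span_scale complex_vector.span_base)
    have "x - ?y = 0"
    proof (rule ccontr)
      assume r: "x - ?y \<noteq> 0"
      define e where "e = (1 / norm (x - ?y)) *\<^sub>R (x - ?y)"
      have e: "norm e = 1" using r by (simp add: e_def)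
      have orth: "cinner v e = 0" if "v \<in> E" for v
        using orthonormal_residual[OF E(1) fin that, of x] by (simp add: e_def cinner_scaleR_right)
      then have "e \<notin> E" using e orth[of e] by auto
      moreover have "orthonormal (insert e E) (\<lambda>v. v)"
        by (rule orthonormal_insert[OF E(1)]) (use e orth in auto)
      ultimately show False
        using n(2)[of "Suc n"] E fin by force
    qed
    then show ?thesis using y by simp
  qed
  then have "orthonormal_basis E"
    using E fin by (auto simp: orthonormal_basis_def orthonormal_def)
  then show ?thesis by blast
qed

lemma orthonormal_basis_expansion:
  assumes "orthonormal_basis B"
  shows "x = (\<Sum>e\<in>B. cinner e x *\<^sub>C e)"
proof -
  have B: "finite B" "orthonormal B (\<lambda>v. v)" "complex_vector.span B = UNIV"
    using assms by (auto simp: orthonormal_basis_def orthonormal_def)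
  let ?r = "x - (\<Sum>e\<in>B. cinner e x *\<^sub>C e)"
  have "cinner ?r y = 0" for y
  proof -
    have "y \<in> complex_vector.span B" using B by simp
    then show ?thesis
    proof (induction rule: complex_vector.span_induct_alt)
      case (step c w z)
      then show ?case
        using orthonormal_residual[OF B(2,1), of w x] cinner_eq_zero_commute[of w ?r]
        by (simp add: cinner_add_right cinner_scaleC_right)
    qed simp
  qed
  then have "?r = 0" by (metis cinner_self_eq_zero)
  then show ?thesis by simp
qed

lemma Parseval:
  assumes "orthonormal_basis B"
  shows "(\<Sum>e\<in>B. (cmod (cinner e x))\<^sup>2) = (norm x)\<^sup>2"
proof -
  have B: "finite B" "orthonormal B (\<lambda>v. v)"
    using assms by (auto simp: orthonormal_basis_def orthonormal_def)
  show ?thesis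
    using Bessel_residual[OF B(2,1), of x] orthonormal_basis_expansion[OF assms, of x] by simp
qed

text \<open>In an orthonormal basis the coordinates of a unit vector lie in the closed unit disc.
  The sphere is therefore a closed subset of a compact set, built as a continuous image one
  coordinate at a time.\<close>

lemma compact_unit_sphere: "compact {x::'h. norm x = 1}"
proof -
  obtain B :: "'h set" where B: "orthonormal_basis B" using ex_orthonormal_basis by blast
  have bl: "bounded_linear (\<lambda>c. c *\<^sub>C e)" for e :: 'h
    by (rule bounded_linear_intro[where K = "norm e"])
      (simp_all add: scaleC_add_left norm_scaleC scaleR_conv_of_real flip: scaleC_of_real)
  have "\<exists>C. compact C \<and> (\<forall>c. (\<forall>e. cmod (c e) \<le> 1) \<longrightarrow> (\<Sum>e\<in>F. c e *\<^sub>C e) \<in> C)"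
    if "finite F" for F :: "'h set"
    using that
  proof induction
    case empty
    show ?case by (rule exI[of _ "{0}"]) simp
  next
    case (insert e F)
    then obtain C where C: "compact C" "\<And>c. (\<forall>e. cmod (c e) \<le> 1) \<Longrightarrow> (\<Sum>e\<in>F. c e *\<^sub>C e) \<in> C"
      by blast
    let ?g = "\<lambda>(c, y). c *\<^sub>C e + y"
    let ?C = "?g ` (cball 0 1 \<times> C)"
    have "continuous_on (cball 0 1 \<times> C) ?g"
      unfolding case_prod_beta
      by (intro continuous_on_add bounded_linear.continuous_on[OF bl] continuous_intros)
    then have "compact ?C"
      by (intro compact_continuous_image compact_Times C(1) compact_cball)
    moreover have "(\<Sum>e\<in>insert e F. c e *\<^sub>C e) \<in> ?C" if c: "\<forall>e. cmod (c e) \<le> 1" for c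
    proof (rule image_eqI)
      show "(\<Sum>e\<in>insert e F. c e *\<^sub>C e) = ?g (c e, \<Sum>e\<in>F. c e *\<^sub>C e)"
        using insert.hyps by simp
      show "(c e, \<Sum>e\<in>F. c e *\<^sub>C e) \<in> cball 0 1 \<times> C"
        using c C(2)[OF c] by simp
    qed
    ultimately show ?case by blast
  qed
  moreover have "finite B" using B by (simp add: orthonormal_basis_def)
  ultimately obtain C
    where C: "compact C" "\<And>c. (\<forall>e. cmod (c e) \<le> 1) \<Longrightarrow> (\<Sum>e\<in>B. c e *\<^sub>C e) \<in> C"
    by metis
  have "x \<in> C" if "norm x = 1" for x
  proof -
    have nB: "norm e = 1" if "e \<in> B" for e
      using B that orthonormal_norm[of B "\<lambda>v. v" e]
      by (simp add: orthonormal_basis_def orthonormal_def)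
    \<comment> \<open>The coefficients are cut off to 0 outside \<open>B\<close> because
      \<open>C\<close> was built for coefficient functions bounded by 1 everywhere.\<close>
    have "(\<Sum>e\<in>B. (if e \<in> B then cinner e x else 0) *\<^sub>C e) \<in> C"
      by (rule C(2)) (use cmod_cinner_le_1[OF nB that] in auto)
    moreover have "(\<Sum>e\<in>B. (if e \<in> B then cinner e x else 0) *\<^sub>C e) = x"
      using orthonormal_basis_expansion[OF B, of x] by simp
    ultimately show ?thesis by simp
  qed
  then have "C \<inter> {x::'h. norm x = 1} = {x. norm x = 1}" by auto
  moreover have "closed {x::'h. norm x = 1}"
    by (intro closed_Collect_eq continuous_intros)
  ultimately show ?thesis
    using compact_Int_closed[OF C(1)] by metis
qed

section \<open>Deflation and the existence of singular value decompositions\<close>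

lemma clinear_bounded_linear:
  fixes a :: "'h \<Rightarrow> 'h"
  assumes a: "clinear a"
  shows "bounded_linear a"
proof -
  obtain B :: "'h set" where B: "orthonormal_basis B" using ex_orthonormal_basis by blast
  then have nB: "norm e = 1" if "e \<in> B" for e
    using that orthonormal_norm[of B "\<lambda>v. v" e] by (simp add: orthonormal_basis_def orthonormal_def)
  show ?thesis
  proof (rule bounded_linear_intro)
    fix x
    have "norm (a x) = norm (\<Sum>e\<in>B. cinner e x *\<^sub>C a e)"
      by (subst orthonormal_basis_expansion[OF B, of x]) (simp add: clinear_simps[OF a])
    also have "\<dots> \<le> (\<Sum>e\<in>B. norm x * norm (a e))"
    proof (rule sum_norm_le)
      show "norm (cinner e x *\<^sub>C a e) \<le> norm x * norm (a e)" if "e \<in> B" for e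
        using Cauchy_Schwarz[of e x] nB[OF that] by (simp add: norm_scaleC mult_right_mono)
    qed
    finally show "norm (a x) \<le> norm x * (\<Sum>e\<in>B. norm (a e))"
      by (simp add: sum_distrib_left)
  qed (simp_all add: clinear_add[OF a] clinear_scaleR[OF a])
qed

lemma ex_top_pair:
  fixes a :: "'h \<Rightarrow> 'h"
  assumes a: "clinear a" and nz: "a x0 \<noteq> 0"
  obtains S u v where "top_pair a S u v"
proof -
  have x0: "x0 \<noteq> 0" using nz clinear_0[OF a] by auto
  have "continuous_on {x. norm x = 1} (\<lambda>x. norm (a x))"
    by (intro continuous_on_norm linear_continuous_on clinear_bounded_linear a)
  moreover have "(1 / norm x0) *\<^sub>R x0 \<in> {x. norm x = 1}" using x0 by simp
  ultimately obtain v where v: "norm v = 1" "\<And>x. norm x = 1 \<Longrightarrow> norm (a x) \<le> norm (a v)"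
    using continuous_attains_sup[OF compact_unit_sphere, of "\<lambda>x. norm (a x)"] by blast
  have le: "norm (a x) \<le> norm (a v) * norm x" for x
  proof (cases "x = 0")
    case False
    then have "norm (a ((1 / norm x) *\<^sub>R x)) \<le> norm (a v)" by (intro v) simp
    then show ?thesis using False by (simp add: clinear_scaleR[OF a] field_simps)
  qed (simp add: clinear_0[OF a])
  have pos: "0 < norm (a v)"
    using le[of x0] nz by (cases "a v = 0") auto
  have "top_pair a (norm (a v)) ((1 / norm (a v)) *\<^sub>R a v) v"
    using pos v(1) le by (simp add: top_pair_def)
  then show ?thesis by (rule that)
qed

text \<open>This is in effect induction on the rank. Each deflation at a top pair puts one more
  orthonormal vector, namely \<open>v\<close>, into the kernel.\<close>

lemma deflation_induct [consumes 1, case_names zero deflate]: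
  fixes a :: "'h \<Rightarrow> 'h"
  assumes "clinear a" and zero: "P (\<lambda>x. 0)"
    and step: "\<And>a S u v. clinear a \<Longrightarrow> top_pair a S u v \<Longrightarrow> P (deflate a S u v) \<Longrightarrow> P a"
  shows "P a"
proof -
  \<comment> \<open>\<open>E\<close> collects orthonormal kernel vectors and \<open>k\<close> counts
    those still missing. The new \<open>v\<close> is orthogonal to \<open>E\<close> by
    \<open>top_pair_kernel\<close>. At \<open>k = 0\<close> a nonzero operator would give an
    orthonormal set with more than \<open>card B0\<close> elements.\<close>
  have "P a" if "clinear a" "orthonormal E (\<lambda>v. v)" "\<forall>x\<in>E. a x = 0" "card E + k = card B0"
    for k and a :: "'h \<Rightarrow> 'h" and E
    using that
  proof (induction k arbitrary: a E)
    case (0 a E)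
    have "a x = 0" for x
    proof (rule ccontr)
      assume "a x \<noteq> 0"
      then obtain S u v where t: "top_pair a S u v" using ex_top_pair[OF 0(1)] by blast
      have v: "cinner w v = 0" if "w \<in> E" for w
        using top_pair_kernel[OF 0(1) t, of w] 0 that by (simp add: cinner_eq_zero_commute)
      have "v \<notin> E" using v[of v] t by (auto simp: top_pair_def)
      moreover have "orthonormal (insert v E) (\<lambda>v. v)"
        by (rule orthonormal_insert[OF 0(2)]) (use v t in \<open>auto simp: top_pair_def\<close>)
      ultimately show False
        using orthonormal_card_le[of "insert v E"] 0 by simp
    qed
    then have "a = (\<lambda>x. 0)" by auto
    then show ?case using zero by simp
  next
    case (Suc k a E)
    show ?case
    proof (cases "\<forall>x. a x = 0")
      case True
      then have "a = (\<lambda>x. 0)" by auto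
      then show ?thesis using zero by simp
    next
      case False
      then obtain S u v where t: "top_pair a S u v" using ex_top_pair[OF Suc.prems(1)] by blast
      have v: "cinner v w = 0" if "w \<in> E" for w
        using top_pair_kernel[OF Suc.prems(1) t, of w] Suc.prems that by simp
      have nE: "v \<notin> E" using v[of v] t by (auto simp: top_pair_def)
      have "orthonormal (insert v E) (\<lambda>v. v)"
        by (rule orthonormal_insert[OF Suc.prems(2)])
          (use v t in \<open>auto simp: top_pair_def cinner_eq_zero_commute\<close>)
      moreover have "\<forall>x\<in>insert v E. deflate a S u v x = 0"
        using v Suc.prems(3) deflate_top(1)[OF Suc.prems(1) t]
        by (auto simp: deflate_def rank_one_def)
      moreover have "card (insert v E) + k = card B0"
        using nE orthonormal_card_le(1)[OF Suc.prems(2)] Suc.prems(4) by simp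
      ultimately have "P (deflate a S u v)"
        by (intro Suc.IH) (use Suc.prems in auto)
      then show ?thesis using step Suc.prems t by blast
    qed
  qed
  from this[of a "{}" "card B0"] show ?thesis
    using assms(1) by (simp add: orthonormal_def)
qed

lemma ex_svd:
  fixes a :: "'h \<Rightarrow> 'h"
  assumes "clinear a"
  obtains V s u where "svd a V s u"
proof -
  have "\<exists>V s u. svd a V s u"
    using assms
  proof (induction rule: deflation_induct)
    case zero
    have "svd (\<lambda>x::'h. 0) {} s u" for s u by (simp add: svd_def orthonormal_def)
    then show ?case by blast
  next
    case (deflate a S u v)
    then obtain V s w where "svd (deflate a S u v) V s w" by blast
    from svd_insert[OF this, of u v S] deflate_top[OF deflate(1,2)] deflate(2)
    have "svd (\<lambda>x. deflate a S u v x + S *\<^sub>R rank_one u v x) (insert v V) (s(v := S)) (w(v := u))"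
      by (simp add: top_pair_def)
    moreover have "(\<lambda>x. deflate a S u v x + S *\<^sub>R rank_one u v x) = a"
      by (simp add: deflate_def)
    ultimately show ?case by metis
  qed
  then show ?thesis using that by blast
qed

end

subsection \<open>Schatten norms in terms of singular values\<close>

lemma adjoint_op_eqI:
  assumes "clinear b" "\<And>x y. cinner (a x) y = cinner x (b y)"
  shows "adjoint_op a = b"
  unfolding adjoint_op_def
proof (rule the_equality)
  show "clinear b \<and> (\<forall>x y. cinner (a x) y = cinner x (b y))" using assms by blast
  fix c assume "clinear c \<and> (\<forall>x y. cinner (a x) y = cinner x (c y))"
  then have "cinner x (c y) = cinner x (b y)" for x y using assms(2) by metis
  then show "c = b" by (intro ext cinner_extensionality)
qed

text \<open>For orthonormal \<open>V\<close> this operator vanishes on the orthogonal complement of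
  \<open>V\<close>. The square of \<open>abs_op a\<close>, its root and its powers all take this
  form, with \<open>V\<close> the right singular vectors.\<close>

definition diag_op :: "'h::complex_inner set \<Rightarrow> ('h \<Rightarrow> real) \<Rightarrow> 'h \<Rightarrow> 'h" where
  "diag_op V s x = (\<Sum>v\<in>V. (of_real (s v) * cinner v x) *\<^sub>C v)"

lemma clinear_weighted_sum [simp]: "clinear (\<lambda>x. \<Sum>v\<in>V. (c v * cinner (w v) x) *\<^sub>C u v)"
  by (auto simp: clinear_iff cinner_simps distrib_left scaleC_add_left sum.distrib
      complex_vector.scale_sum_right mult.left_commute)

lemma clinear_diag_op [simp]: "clinear (diag_op V s)"
  unfolding diag_op_def by simp

lemma svd_adjoint:
  assumes "svd a V s u"
  shows "adjoint_op a = (\<lambda>y. \<Sum>v\<in>V. (of_real (s v) * cinner (u v) y) *\<^sub>C v)"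
proof (rule adjoint_op_eqI)
  fix x y
  have "cinner (a x) y = (\<Sum>v\<in>V. of_real (s v) * cnj (cinner v x) * cinner (u v) y)"
    by (simp add: svd_apply[OF assms] cinner_simps)
  also have "\<dots> = (\<Sum>v\<in>V. (of_real (s v) * cinner (u v) y) * cinner x v)"
    by (intro sum.cong refl) (subst (3) cinner_commute, simp)
  finally show "cinner (a x) y = cinner x (\<Sum>v\<in>V. (of_real (s v) * cinner (u v) y) *\<^sub>C v)"
    by (simp add: cinner_simps)
qed simp

lemma svd_adjoint_comp:
  assumes "svd a V s u"
  shows "adjoint_op a \<circ> a = diag_op V (\<lambda>v. (s v)\<^sup>2)"
proof
  fix x
  have "(adjoint_op a \<circ> a) x = (\<Sum>v\<in>V. (of_real (s v) * (of_real (s v) * cinner v x)) *\<^sub>C v)"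
    by (simp add: svd_adjoint[OF assms] svd_cinner[OF assms])
  also have "\<dots> = diag_op V (\<lambda>v. (s v)\<^sup>2) x"
    by (simp add: diag_op_def power2_eq_square mult.assoc)
  finally show "(adjoint_op a \<circ> a) x = diag_op V (\<lambda>v. (s v)\<^sup>2) x" .
qed

context
  fixes V :: "'h::complex_hilbert set"
  assumes V: "finite V" "orthonormal V (\<lambda>v. v)"
begin

lemma diag_op_vector:
  assumes "v \<in> V"
  shows "diag_op V s v = s v *\<^sub>R v"
proof -
  have "diag_op V s v = (\<Sum>w\<in>V. if w = v then s v *\<^sub>R v else 0)"
    unfolding diag_op_def
    by (intro sum.cong refl) (auto simp: orthonormalD[OF V(2)] assms scaleC_of_real)
  then show ?thesis using assms V by simp
qed

lemma diag_op_orthogonal: "(\<And>v. v \<in> V \<Longrightarrow> cinner v x = 0) \<Longrightarrow> diag_op V s x = 0"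
  by (simp add: diag_op_def)

lemma cinner_diag_op: "v \<in> V \<Longrightarrow> cinner v (diag_op V s x) = of_real (s v) * cinner v x"
  unfolding diag_op_def by (rule orthonormal_expansion[OF V(2,1)])

text \<open>Every vector splits into a combination of \<open>V\<close> and a part orthogonal to
  \<open>V\<close>. The uniqueness proofs for roots and powers check these two parts
  separately.\<close>

lemma clinear_eq_orthonormal:
  fixes f g :: "'h \<Rightarrow> 'h"
  assumes f: "clinear f" and g: "clinear g"
    and eq: "\<And>v. v \<in> V \<Longrightarrow> f v = g v"
    and orth: "\<And>x. (\<And>v. v \<in> V \<Longrightarrow> cinner v x = 0) \<Longrightarrow> f x = g x"
  shows "f = g"
proof
  fix x
  let ?y = "\<Sum>v\<in>V. cinner v x *\<^sub>C v"
  have "f (x - ?y) = g (x - ?y)"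
    by (rule orth) (rule orthonormal_residual[OF V(2,1)])
  moreover have "f ?y = g ?y"
    by (simp add: clinear_simps[OF f] clinear_simps[OF g] eq cong: sum.cong)
  ultimately show "f x = g x"
    by (simp add: clinear_diff[OF f] clinear_diff[OF g])
qed

lemma positive_diag_op:
  assumes "\<And>v. v \<in> V \<Longrightarrow> 0 \<le> s v"
  shows "positive_op (diag_op V s)"
  unfolding positive_op_def
proof (intro conjI allI)
  fix x :: 'h
  have "cinner v x * cinner x v = of_real ((cmod (cinner v x))\<^sup>2)" for v
    using complex_norm_square[of "cinner v x"] by (simp add: cinner_commute[of x v])
  then have "cinner x (diag_op V s x) = of_real (\<Sum>v\<in>V. s v * (cmod (cinner v x))\<^sup>2)"
    by (simp add: diag_op_def cinner_simps mult.assoc)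
  then show "cinner x (diag_op V s x) \<in> \<real>\<^sub>\<ge>\<^sub>0"
    using assms by (simp only: nonneg_Reals_of_real_iff) (simp add: sum_nonneg)
qed simp

lemma sqrt_diag_op:
  assumes s: "\<And>v. v \<in> V \<Longrightarrow> 0 < s v"
  shows "sqrt_op (diag_op V (\<lambda>v. (s v)\<^sup>2)) = diag_op V s"
  unfolding sqrt_op_def
proof (rule the_equality)
  have "diag_op V s (diag_op V s x) = diag_op V (\<lambda>v. (s v)\<^sup>2) x" for x :: 'h
    unfolding diag_op_def[of V s "diag_op V s x"]
    unfolding diag_op_def[of V "\<lambda>v. (s v)\<^sup>2"]
    by (simp add: cinner_diag_op power2_eq_square mult.assoc cong: sum.cong)
  then show "positive_op (diag_op V s) \<and> diag_op V s \<circ> diag_op V s = diag_op V (\<lambda>v. (s v)\<^sup>2)"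
    using s by (auto intro!: positive_diag_op less_imp_le)
next
  fix q :: "'h \<Rightarrow> 'h"
  assume q: "positive_op q \<and> q \<circ> q = diag_op V (\<lambda>v. (s v)\<^sup>2)"
  then have lin: "clinear q" and pos: "\<And>x. 0 \<le> Re (cinner x (q x))"
    and sq: "\<And>x. q (q x) = diag_op V (\<lambda>v. (s v)\<^sup>2) x"
    by (auto simp: positive_op_def complex_nonneg_Reals_iff fun_eq_iff)
  show "q = diag_op V s"
  proof (rule clinear_eq_orthonormal[OF lin clinear_diag_op])
    fix v assume v: "v \<in> V"
    \<comment> \<open>Since \<open>q\<close> squares to \<open>(s v)\<^sup>2\<close> on
      \<open>v\<close>, this \<open>w\<close> satisfies \<open>q w = - s v w\<close>. Positivity of
      \<open>q\<close> leaves only \<open>w = 0\<close>.\<close>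
    define w where "w = q v - s v *\<^sub>R v"
    have "q w = - s v *\<^sub>R w"
      by (simp add: w_def clinear_diff[OF lin] clinear_scaleR[OF lin] sq diag_op_vector[OF v]
          power2_eq_square algebra_simps)
    then have "0 \<le> - (s v * (norm w)\<^sup>2)"
      using pos[of w] by (simp add: cinner_scaleR_right cinner_self flip: of_real_power)
    then have "w = 0"
      using s[OF v] by (simp add: mult_le_0_iff)
    then show "q v = diag_op V s v" by (simp add: w_def diag_op_vector[OF v])
  next
    fix x assume x: "\<And>v. v \<in> V \<Longrightarrow> cinner v x = 0"
    define w where "w = q x"
    have qw: "q w = 0" unfolding w_def sq using x by (rule diag_op_orthogonal)
    have "w = 0"
    proof (rule ccontr)
      assume "w \<noteq> 0"
      then have n: "0 < (norm w)\<^sup>2" by simp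
      \<comment> \<open>As \<open>q w = 0\<close>, the form of \<open>q\<close> at
        \<open>x - t w\<close> has real part \<open>Re (cinner x w) - t * (norm w)\<^sup>2\<close>.
        This \<open>t\<close> makes it equal to -1, against positivity.\<close>
      define t where "t = (Re (cinner x w) + 1) / (norm w)\<^sup>2"
      have "q (x - t *\<^sub>R w) = w"
        by (simp add: clinear_diff[OF lin] clinear_scaleR[OF lin] qw) (simp add: w_def)
      then have "0 \<le> Re (cinner x w) - t * (norm w)\<^sup>2"
        using pos[of "x - t *\<^sub>R w"] by (simp add: cinner_simps cinner_self flip: of_real_power)
      then show False using n by (simp add: t_def)
    qed
    then show "q x = diag_op V s x" using x by (simp add: w_def diag_op_orthogonal)
  qed
qed

lemma powr_diag_op:
  assumes s: "\<And>v. v \<in> V \<Longrightarrow> 0 < s v"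
  shows "powr_op (diag_op V s) p = diag_op V (\<lambda>v. s v powr p)"
  unfolding powr_op_def
proof (rule the_equality)
  have "diag_op V (\<lambda>v. s v powr p) x = (l powr p) *\<^sub>R x"
    if l: "0 \<le> l" and eig: "diag_op V s x = l *\<^sub>R x" for l and x :: 'h
  proof -
    have sv: "s v = l" if "v \<in> V" "cinner v x \<noteq> 0" for v
      using arg_cong[OF eig, of "cinner v"] that by (simp add: cinner_diag_op cinner_scaleR_right)
    \<comment> \<open>Only those \<open>v\<close> with \<open>s v = l\<close> have a nonzero
      coefficient in the eigenvector \<open>x\<close>, so \<open>f\<close> can be pulled out as
      \<open>f l\<close>. What is left is the projection of \<open>x\<close> onto the span of
      \<open>V\<close>, which is \<open>x\<close> itself when \<open>l\<close> is nonzero.\<close>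
    have sums: "diag_op V (\<lambda>v. f (s v)) x = f l *\<^sub>R (\<Sum>v\<in>V. cinner v x *\<^sub>C v)" for f
      unfolding diag_op_def scaleC_of_real[symmetric] complex_vector.scale_sum_right
    proof (intro sum.cong refl)
      show "(of_real (f (s v)) * cinner v x) *\<^sub>C v = of_real (f l) *\<^sub>C cinner v x *\<^sub>C v"
        if "v \<in> V" for v
        using sv[OF that] by (cases "cinner v x = 0") (simp_all add: scaleC_scaleC)
    qed
    show ?thesis
    proof (cases "l = 0")
      case True
      then show ?thesis by (simp add: sums[of "\<lambda>r. r powr p"])
    next
      case False
      then have "(\<Sum>v\<in>V. cinner v x *\<^sub>C v) = x"
        using sums[of "\<lambda>r. r"] eig by simp
      then show ?thesis by (simp add: sums[of "\<lambda>r. r powr p"])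
    qed
  qed
  then show "clinear (diag_op V (\<lambda>v. s v powr p)) \<and> (\<forall>l\<ge>0. \<forall>x. diag_op V s x = l *\<^sub>R x \<longrightarrow>
      diag_op V (\<lambda>v. s v powr p) x = (l powr p) *\<^sub>R x)"
    by simp
next
  fix r
  assume r: "clinear r \<and> (\<forall>l\<ge>0. \<forall>x. diag_op V s x = l *\<^sub>R x \<longrightarrow> r x = (l powr p) *\<^sub>R x)"
  show "r = diag_op V (\<lambda>v. s v powr p)"
  proof (rule clinear_eq_orthonormal)
    fix v assume "v \<in> V"
    then show "r v = diag_op V (\<lambda>v. s v powr p) v"
      using r s[of v] by (simp add: diag_op_vector less_imp_le)
  next
    fix x assume x: "\<And>v. v \<in> V \<Longrightarrow> cinner v x = 0"
    \<comment> \<open>The orthogonal complement lies in the eigenspace for 0, where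
      \<open>0 powr p = 0\<close> makes the power vanish too.\<close>
    then have "diag_op V s x = 0 *\<^sub>R x" by (simp add: diag_op_orthogonal)
    then have "r x = (0 powr p) *\<^sub>R x" using r by blast
    then show "r x = diag_op V (\<lambda>v. s v powr p) x"
      using x by (simp add: diag_op_orthogonal)
  qed (use r in simp_all)
qed

end

text \<open>Unlike the norm, its p-th power is additive when an orthogonal rank-one piece is split
  off.\<close>

definition schatten_power :: "real \<Rightarrow> ('h::complex_hilbert \<Rightarrow> 'h) \<Rightarrow> real" where
  "schatten_power p a = schatten_norm p a powr p"

context finite_dim_hilbert
begin

text \<open>Summing first over the chosen basis, Parseval turns each inner sum into
  \<open>s v * (norm v)\<^sup>2\<close>, so the result is independent of that choice.\<close>

lemma trace_diag_op:
  fixes V :: "'h set"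
  assumes V: "finite V" "orthonormal V (\<lambda>v. v)"
  shows "trace_op (diag_op V s) = of_real (\<Sum>v\<in>V. s v)"
proof -
  define B :: "'h set" where "B = (SOME B. orthonormal_basis B)"
  have B: "orthonormal_basis B"
    unfolding B_def by (rule someI_ex[OF ex_orthonormal_basis])
  have sq: "cinner v e * cinner e v = of_real ((cmod (cinner e v))\<^sup>2)" for e v :: 'h
    using complex_norm_square[of "cinner e v"]
    by (simp add: cinner_commute[of v e] mult.commute)
  have "trace_op (diag_op V s) = (\<Sum>e\<in>B. \<Sum>v\<in>V. of_real (s v * (cmod (cinner e v))\<^sup>2))"
    unfolding trace_op_def B_def[symmetric] diag_op_def
    by (simp add: cinner_simps mult.assoc sq)
  also have "\<dots> = (\<Sum>v\<in>V. \<Sum>e\<in>B. of_real (s v * (cmod (cinner e v))\<^sup>2))"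
    by (rule sum.swap)
  also have "\<dots> = of_real (\<Sum>v\<in>V. s v * (norm v)\<^sup>2)"
    by (simp only: Parseval[OF B, symmetric] sum_distrib_left of_real_sum)
  also have "(\<Sum>v\<in>V. s v * (norm v)\<^sup>2) = (\<Sum>v\<in>V. s v)"
    using orthonormal_norm[OF V(2)] by simp
  finally show ?thesis .
qed

lemma schatten_power_svd:
  fixes a :: "'h \<Rightarrow> 'h"
  assumes svd: "svd a V s u" and p: "0 < p"
  shows "schatten_power p a = (\<Sum>v\<in>V. s v powr p)"
proof -
  note V = svd_finite[OF svd] svd_right[OF svd]
  have "abs_op a = diag_op V s"
    unfolding abs_op_def svd_adjoint_comp[OF svd]
    by (rule sqrt_diag_op[OF V svd_pos[OF svd]])
  then have "schatten_norm p a = (\<Sum>v\<in>V. s v powr p) powr (1 / p)"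
    unfolding schatten_norm_def
    by (simp add: powr_diag_op[OF V svd_pos[OF svd]] trace_diag_op[OF V])
  then show ?thesis
    using p by (simp add: schatten_power_def powr_powr sum_nonneg)
qed

end

lemma rank_one_min_partial_isometry:
  fixes u v :: "'h::complex_hilbert"
  assumes "norm u = 1" "norm v = 1"
  shows "rank_one u v \<in> min_partial_isometries"
proof -
  have "adjoint_op (rank_one u v) = rank_one v u"
    by (rule adjoint_op_eqI)
      (simp_all add: rank_one_def cinner_simps mult.commute cinner_commute[of _ v])
  then have "rank_one u v \<circ> adjoint_op (rank_one u v) \<circ> rank_one u v = rank_one u v"
    using assms by (simp add: fun_eq_iff rank_one_def cinner_simps)
  moreover have "complex_vector.dim (range (rank_one u v)) = 1"
  proof (rule complex_vector.dim_unique)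
    show "{u} \<subseteq> range (rank_one u v)"
      using assms by (simp add: image_iff rank_one_def) (metis cinner_self_unit scaleC_one)
    show "range (rank_one u v) \<subseteq> complex_vector.span {u}"
      by (auto simp: rank_one_def intro!: complex_vector.span_scale[OF complex_vector.span_base])
    show "complex_vector.independent {u}"
      using assms by (auto simp: complex_vector.dependent_single)
  qed simp
  ultimately show ?thesis
    by (simp add: min_partial_isometries_def partial_isometry_def)
qed

subsection \<open>Rank-one perturbations\<close>

text \<open>Each diagonal entry of \<open>a\<close> is dominated by an average of the singular
  values with weights \<open>D j v\<close>. Bessel's inequality makes these weights doubly
  substochastic: Jensen is applied along the rows, and the column sums bound the result.\<close>

lemma svd_Peierls:
  assumes svd: "svd a V s u" and p: "1 < p" and J: "finite J"
    and w: "orthonormal J w" and z: "orthonormal J z"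
  shows "(\<Sum>j\<in>J. cmod (cinner (w j) (a (z j))) powr p) \<le> (\<Sum>v\<in>V. s v powr p)"
proof -
  note V = svd_finite[OF svd]
  \<comment> \<open>The natural weights are products of two moduli. Replacing them by the mean of
    the squares enlarges them and makes Bessel's inequality applicable to each square.\<close>
  define D where
    "D j v = ((cmod (cinner (u v) (w j)))\<^sup>2 + (cmod (cinner v (z j)))\<^sup>2) / 2" for j v
  have cmod_commute: "cmod (cinner x y) = cmod (cinner y x)" for x y :: 'a
    by (metis cinner_commute complex_mod_cnj)
  have rows: "(\<Sum>v\<in>V. D j v) \<le> 1" if "j \<in> J" for j
    using Bessel[OF svd_left[OF svd] V, of "w j"] Bessel[OF svd_right[OF svd] V, of "z j"]
      orthonormal_norm[OF w that] orthonormal_norm[OF z that]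
    by (simp add: D_def sum.distrib flip: sum_divide_distrib)
  have cols: "(\<Sum>j\<in>J. D j v) \<le> 1" if "v \<in> V" for v
    using Bessel[OF w J, of "u v"] Bessel[OF z J, of v]
      orthonormal_norm[OF svd_left[OF svd] that] orthonormal_norm[OF svd_right[OF svd] that]
    by (simp add: D_def sum.distrib cmod_commute[of "u v"] cmod_commute[of v]
        flip: sum_divide_distrib)
  have "cmod (cinner (w j) (a (z j))) \<le> (\<Sum>v\<in>V. D j v * s v)" for j
    unfolding svd_apply[OF svd] cinner_sum_right
  proof (rule sum_norm_le)
    fix v assume v: "v \<in> V"
    let ?x = "cmod (cinner v (z j))" and ?y = "cmod (cinner (u v) (w j))"
    have "?x * ?y \<le> D j v"
      using zero_le_power2[of "?x - ?y"] by (simp add: D_def power2_diff)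
    then have "s v * (?x * ?y) \<le> s v * D j v"
      using svd_pos[OF svd v] by (intro mult_left_mono) auto
    then show "cmod (cinner (w j) ((of_real (s v) * cinner v (z j)) *\<^sub>C u v)) \<le> D j v * s v"
      using svd_pos[OF svd v]
      by (simp add: cinner_scaleC_right norm_mult cmod_commute[of "w j"] mult.commute mult.left_commute)
  qed
  then have "(\<Sum>j\<in>J. cmod (cinner (w j) (a (z j))) powr p)
      \<le> (\<Sum>j\<in>J. (\<Sum>v\<in>V. D j v * s v) powr p)"
    using p by (intro sum_mono powr_mono2) auto
  also have "\<dots> \<le> (\<Sum>j\<in>J. \<Sum>v\<in>V. D j v * s v powr p)"
    using rows svd_pos[OF svd]
    by (intro sum_mono powr_Jensen_substochastic[OF p V]) (auto simp: D_def less_imp_le)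
  also have "\<dots> = (\<Sum>v\<in>V. (\<Sum>j\<in>J. D j v) * s v powr p)"
    by (subst sum.swap) (simp add: sum_distrib_right)
  also have "\<dots> \<le> (\<Sum>v\<in>V. 1 * s v powr p)"
    by (intro sum_mono mult_right_mono cols) auto
  finally show ?thesis by simp
qed

text \<open>A unit vector \<open>j\<close> can be stretched to length \<open>S + \<gamma>\<close>
  only if every estimate in the triangle inequality is tight. First \<open>cinner y j\<close> must
  have modulus 1, so \<open>j\<close> is a phase times \<open>y\<close>; then \<open>a y\<close>
  must have length \<open>S\<close> and point in the direction of \<open>x\<close>.\<close>

lemma top_pair_perturbation:
  assumes a: "clinear a" and top: "top_pair a S u v" and \<gamma>: "0 < \<gamma>"
    and xy: "norm x = 1" "norm y = 1" and j: "norm j = 1"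
    and large: "S + \<gamma> \<le> norm (a j + \<gamma> *\<^sub>R rank_one x y j)"
  shows "top_pair a S x y"
proof -
  have S: "0 < S" and le: "\<And>z. norm (a z) \<le> S * norm z"
    using top by (auto simp: top_pair_def)
  define \<beta> where "\<beta> = cinner y j"
  have "norm (a j + \<gamma> *\<^sub>R rank_one x y j) \<le> norm (a j) + \<gamma> * cmod \<beta>"
    using norm_triangle_ineq[of "a j" "\<gamma> *\<^sub>R rank_one x y j"] \<gamma> xy
    by (simp add: rank_one_def norm_scaleC \<beta>_def)
  also have "\<dots> \<le> S + \<gamma> * cmod \<beta>" using le[of j] j by simp
  finally have "\<gamma> * 1 \<le> \<gamma> * cmod \<beta>" using large by linarith
  then have "1 \<le> cmod \<beta>" using \<gamma> by simp
  then have \<beta>: "cmod \<beta> = 1"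
    using cmod_cinner_le_1[OF xy(2) j] by (simp add: \<beta>_def)
  have "cinner j (\<beta> *\<^sub>C y) = of_real ((cmod \<beta>)\<^sup>2)"
    using complex_norm_square[of \<beta>] by (simp add: cinner_scaleC_right \<beta>_def cinner_commute[of j y])
  then have "(norm (j - \<beta> *\<^sub>C y))\<^sup>2 = 0"
    by (simp add: norm_diff_sq norm_scaleC \<beta> j xy)
  then have j_eq: "j = \<beta> *\<^sub>C y" by simp
  have "a j + \<gamma> *\<^sub>R rank_one x y j = \<beta> *\<^sub>C (a y + \<gamma> *\<^sub>R x)"
    unfolding j_eq
    by (simp add: clinear_scaleC[OF a] rank_one_def cinner_scaleC_right xy scaleC_add_right
        mult.commute flip: scaleC_of_real)
  then have "S + \<gamma> \<le> norm (a y + \<gamma> *\<^sub>R x)"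
    using large by (simp add: norm_scaleC \<beta>)
  \<comment> \<open>Expanding the square yields \<open>Re (cinner (a y) x)\<close> at least
    \<open>S\<close>. Together with \<open>norm (a y)\<close> at most \<open>S\<close>, this makes
    the distance from \<open>a y\<close> to \<open>S x\<close> zero.\<close>
  then have "(S + \<gamma>)\<^sup>2 \<le> (norm (a y + \<gamma> *\<^sub>R x))\<^sup>2"
    using S \<gamma> by (intro power_mono) auto
  then have 1: "(S + \<gamma>)\<^sup>2 \<le> (norm (a y))\<^sup>2 + 2 * (\<gamma> * Re (cinner (a y) x)) + \<gamma>\<^sup>2"
    by (simp add: norm_add_sq cinner_scaleR_right xy)
  have 2: "(norm (a y))\<^sup>2 \<le> S\<^sup>2" using le[of y] xy by (intro power_mono) auto
  have "\<gamma> * S \<le> \<gamma> * Re (cinner (a y) x)"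
    using 1 2 by (simp add: power2_sum algebra_simps)
  then have "S \<le> Re (cinner (a y) x)" using \<gamma> by simp
  then have "S\<^sup>2 \<le> S * Re (cinner (a y) x)" using S by (simp add: power2_eq_square)
  moreover have "(norm (a y - S *\<^sub>R x))\<^sup>2 = (norm (a y))\<^sup>2 - 2 * (S * Re (cinner (a y) x)) + S\<^sup>2"
    by (simp add: norm_diff_sq cinner_scaleR_right xy)
  ultimately have "(norm (a y - S *\<^sub>R x))\<^sup>2 \<le> 0" using 2 by linarith
  then have "a y = S *\<^sub>R x" by simp
  then show ?thesis using S xy le by (simp add: top_pair_def)
qed

lemma clinear_perturb: "clinear a \<Longrightarrow> clinear (\<lambda>z. a z + r *\<^sub>R rank_one x y z)"
  by (intro clinear_add_op clinear_scaleR_rank_one)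

context finite_dim_hilbert
begin

text \<open>The scalar estimate \<open>powr_perturbation_le\<close> is applied to each singular
  value of \<open>c\<close> and summed. In the equality case some singular value of \<open>c\<close>
  must reach \<open>S + \<gamma>\<close>, and \<open>top_pair_perturbation\<close> turns its right
  vector into the claim about \<open>x\<close> and \<open>y\<close>.\<close>

lemma schatten_power_perturb:
  fixes a :: "'h \<Rightarrow> 'h"
  assumes a: "clinear a" and top: "top_pair a S u v" and p: "1 < p" and \<gamma>: "0 < \<gamma>"
    and xy: "norm x = 1" "norm y = 1"
  defines "c \<equiv> (\<lambda>z. a z + \<gamma> *\<^sub>R rank_one x y z)"
  shows "schatten_power p c \<le> schatten_power p a + ((S + \<gamma>) powr p - S powr p)" (is ?le)
    and "schatten_power p c = schatten_power p a + ((S + \<gamma>) powr p - S powr p) \<Longrightarrow>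
      top_pair a S x y"
proof -
  have S: "0 < S" and le: "\<And>z. norm (a z) \<le> S * norm z"
    using top by (auto simp: top_pair_def)
  have p0: "0 < p" using p by simp
  obtain V s l where svda: "svd a V s l" using ex_svd[OF a] .
  have "clinear c" unfolding c_def by (rule clinear_perturb[OF a])
  then obtain W r w where svdc: "svd c W r w" using ex_svd by blast
  note W = svd_finite[OF svdc] and w = svd_left[OF svdc] and z = svd_right[OF svdc]
  \<comment> \<open>In the singular bases of \<open>c\<close>, \<open>A j\<close> is the modulus of
    the diagonal entry of \<open>a\<close> and \<open>t j\<close> that of the rank-one operator. By
    Bessel's inequality the weights \<open>t j\<close> sum to at most 1.\<close>
  define A t where "A j = cmod (cinner (w j) (a j))" and "t j = cmod (cinner (w j) x) * cmod (cinner y j)"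
    for j
  define \<Delta> where "\<Delta> = (S + \<gamma>) powr p - S powr p"
  have \<Delta>: "0 < \<Delta>" unfolding \<Delta>_def using S \<gamma> p by (simp add: powr_less_mono2)
  have nw: "norm (w j) = 1" and nj: "norm j = 1" if "j \<in> W" for j
    using that orthonormal_norm[OF w] orthonormal_norm[OF z] by auto
  have AS: "A j \<le> S" if "j \<in> W" for j
    using Cauchy_Schwarz[of "w j" "a j"] le[of j] nw[OF that] nj[OF that] by (simp add: A_def)
  have t1: "t j \<le> 1" if "j \<in> W" for j
    using cmod_cinner_le_1[OF nw[OF that] xy(1)] cmod_cinner_le_1[OF xy(2) nj[OF that]]
    by (simp add: t_def mult_le_one)
  have rj: "r j \<le> A j + \<gamma> * t j" if "j \<in> W" for j
  proof -
    have "cmod (cinner (w j) (c j)) = r j"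
      using svd_cinner[OF svdc that, of j] svd_pos[OF svdc that] nj[OF that] by simp
    also have "cinner (w j) (c j) = cinner (w j) (a j) + of_real \<gamma> * (cinner (w j) x * cinner y j)"
      by (simp add: c_def rank_one_def cinner_simps)
    finally show ?thesis
      using norm_triangle_ineq[of "cinner (w j) (a j)" "of_real \<gamma> * (cinner (w j) x * cinner y j)"] \<gamma>
      by (simp add: A_def t_def norm_mult)
  qed
  have "(\<Sum>j\<in>W. t j) \<le> (\<Sum>j\<in>W. ((cmod (cinner (w j) x))\<^sup>2 + (cmod (cinner j y))\<^sup>2) / 2)"
  proof (rule sum_mono)
    fix j
    have "cmod (cinner y j) = cmod (cinner j y)" by (metis cinner_commute complex_mod_cnj)
    then show "t j \<le> ((cmod (cinner (w j) x))\<^sup>2 + (cmod (cinner j y))\<^sup>2) / 2"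
      using zero_le_power2[of "cmod (cinner (w j) x) - cmod (cinner j y)"]
      by (simp add: t_def power2_diff)
  qed
  also have "\<dots> \<le> 1"
    using Bessel[OF w W, of x] Bessel[OF z W, of y] xy
    by (simp add: sum.distrib flip: sum_divide_distrib)
  finally have t_sum: "(\<Sum>j\<in>W. t j) \<le> 1" .
  have A_sum: "(\<Sum>j\<in>W. A j powr p) \<le> schatten_power p a"
    unfolding schatten_power_svd[OF svda p0] A_def by (rule svd_Peierls[OF svda p W w z])
  have c_sum: "schatten_power p c = (\<Sum>j\<in>W. r j powr p)"
    by (rule schatten_power_svd[OF svdc p0])
  have le_j: "r j powr p \<le> A j powr p + t j * \<Delta>" if "j \<in> W" for j
    unfolding \<Delta>_def
    by (rule powr_perturbation_le[OF p _ AS[OF that] \<gamma> _ t1[OF that] _ rj[OF that]])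
      (use svd_pos[OF svdc that] in \<open>auto simp: A_def t_def\<close>)
  have sums: "(\<Sum>j\<in>W. A j powr p + t j * \<Delta>) = (\<Sum>j\<in>W. A j powr p) + (\<Sum>j\<in>W. t j) * \<Delta>"
    by (simp add: sum.distrib sum_distrib_right)
  have c_le: "schatten_power p c \<le> (\<Sum>j\<in>W. A j powr p) + (\<Sum>j\<in>W. t j) * \<Delta>"
    unfolding c_sum sums[symmetric] by (rule sum_mono[OF le_j])
  have t\<Delta>: "(\<Sum>j\<in>W. t j) * \<Delta> \<le> \<Delta>"
    using mult_right_mono[OF t_sum, of \<Delta>] \<Delta> by simp
  show ?le
    using c_le t\<Delta> A_sum unfolding \<Delta>_def by linarith
  assume "schatten_power p c = schatten_power p a + ((S + \<gamma>) powr p - S powr p)"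
  then have eq: "schatten_power p c = schatten_power p a + \<Delta>" by (simp add: \<Delta>_def)
  \<comment> \<open>If all singular values stay below \<open>S + \<gamma>\<close>, the estimate is
    strict at any index with positive weight. If there is no such index, the positive gain
    \<open>\<Delta>\<close> is missed altogether.\<close>
  have "\<exists>j\<in>W. S + \<gamma> \<le> r j"
  proof (rule ccontr)
    assume "\<not> ?thesis"
    then have small: "\<And>j. j \<in> W \<Longrightarrow> r j < S + \<gamma>" by force
    show False
    proof (cases "\<exists>j\<in>W. 0 < t j")
      case True
      then obtain j where j: "j \<in> W" "0 < t j" by blast
      have "r j powr p < A j powr p + t j * \<Delta>"
        unfolding \<Delta>_def
        by (rule powr_perturbation_less[OF p _ AS[OF j(1)] \<gamma> j(2) t1[OF j(1)] _ rj[OF j(1)] small[OF j(1)]])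
          (use svd_pos[OF svdc j(1)] in \<open>auto simp: A_def\<close>)
      then have "(\<Sum>j\<in>W. r j powr p) < (\<Sum>j\<in>W. A j powr p + t j * \<Delta>)"
        by (intro sum_strict_mono_ex1[OF W]) (use le_j j in auto)
      then show False
        using eq t\<Delta> A_sum unfolding c_sum sums by linarith
    next
      case False
      then have "t j \<le> 0" if "j \<in> W" for j using that by force
      then have "(\<Sum>j\<in>W. t j) \<le> 0" by (rule sum_nonpos)
      then have "(\<Sum>j\<in>W. t j) * \<Delta> \<le> 0" using \<Delta> by (simp add: mult_le_0_iff)
      then show False using eq c_le A_sum \<Delta> by linarith
    qed
  qed
  then obtain j where j: "j \<in> W" "S + \<gamma> \<le> r j" by blast
  have "norm (c j) = r j"
    using svd_vector[OF svdc j(1)] nw[OF j(1)] svd_pos[OF svdc j(1)] by simp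
  then show "top_pair a S x y"
    using top_pair_perturbation[OF a top \<gamma> xy nj[OF j(1)]] j(2) by (simp add: c_def)
qed

text \<open>By \<open>svd_insert\<close> the rank-one term contributes exactly one further singular
  value \<open>S\<close>. As \<open>S\<close> is any positive number, the same fact covers both
  restoring a deflated piece and enlarging it to \<open>S + \<gamma>\<close>.\<close>

lemma schatten_power_add:
  fixes a :: "'h \<Rightarrow> 'h"
  assumes a: "clinear a" and p: "0 < p" and uv: "norm u = 1" "norm v = 1"
    and v: "a v = 0" and u: "\<And>x. cinner u (a x) = 0" and S: "0 < S"
  shows "schatten_power p (\<lambda>x. a x + S *\<^sub>R rank_one u v x) = schatten_power p a + S powr p"
proof -
  obtain V s l where svd: "svd a V s l" using ex_svd[OF a] .
  have ins: "v \<notin> V" "svd (\<lambda>x. a x + S *\<^sub>R rank_one u v x) (insert v V) (s(v := S)) (l(v := u))"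
    using svd_insert[OF svd uv v u S] by auto
  have "(\<Sum>w\<in>V. (s(v := S)) w powr p) = (\<Sum>w\<in>V. s w powr p)"
    using ins(1) by (intro sum.cong) auto
  then show ?thesis
    using ins(1) svd_finite[OF svd]
    by (simp add: schatten_power_svd[OF svd p] schatten_power_svd[OF ins(2) p] del: fun_upd_apply)
      simp
qed

lemma schatten_power_deflate:
  fixes a :: "'h \<Rightarrow> 'h"
  assumes a: "clinear a" and top: "top_pair a S u v" and p: "0 < p"
  shows "schatten_power p a = schatten_power p (deflate a S u v) + S powr p"
proof -
  have "schatten_power p (\<lambda>x. deflate a S u v x + S *\<^sub>R rank_one u v x)
      = schatten_power p (deflate a S u v) + S powr p"
    by (rule schatten_power_add) (use a top p deflate_top[OF a top] in \<open>auto simp: top_pair_def\<close>)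
  then show ?thesis by (simp add: deflate_def)
qed

text \<open>At a top pair the perturbation replaces the singular value \<open>S\<close> by
  \<open>S + \<gamma>\<close> and leaves the deflated part alone, so the bound of
  \<open>schatten_power_perturb\<close> is attained.\<close>

lemma schatten_power_perturb_top:
  fixes a :: "'h \<Rightarrow> 'h"
  assumes a: "clinear a" and top: "top_pair a S u v" and p: "0 < p" and \<gamma>: "0 < \<gamma>"
  shows "schatten_power p (\<lambda>z. a z + \<gamma> *\<^sub>R rank_one u v z)
    = schatten_power p a + ((S + \<gamma>) powr p - S powr p)"
proof -
  have "schatten_power p (\<lambda>x. deflate a S u v x + (S + \<gamma>) *\<^sub>R rank_one u v x)
      = schatten_power p (deflate a S u v) + (S + \<gamma>) powr p"
    by (rule schatten_power_add)
      (use a top p \<gamma> deflate_top[OF a top] in \<open>auto simp: top_pair_def\<close>)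
  then show ?thesis
    by (simp add: schatten_power_deflate[OF a top p] deflate_def scaleR_add_left)
qed

lemma schatten_power_0: "schatten_power p (\<lambda>x::'h. 0) = 0" if "0 < p"
proof -
  have "svd (\<lambda>x::'h. 0) {} (\<lambda>_. 1) (\<lambda>v. v)" by (simp add: svd_def orthonormal_def)
  from schatten_power_svd[OF this that] show ?thesis by simp
qed

lemma schatten_power_pos:
  fixes a :: "'h \<Rightarrow> 'h"
  assumes a: "clinear a" and top: "top_pair a S u v" and p: "0 < p"
  shows "0 < schatten_power p a"
proof -
  have "0 \<le> schatten_power p (deflate a S u v)" by (simp add: schatten_power_def)
  moreover have "0 < S powr p" using top by (simp add: top_pair_def)
  ultimately show ?thesis unfolding schatten_power_deflate[OF a top p] by linarith
qed

section \<open>Comparison of two operators through their perturbations\<close>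

lemma top_value_le:
  fixes a b :: "'h \<Rightarrow> 'h"
  assumes a: "clinear a" and topa: "top_pair a S u v"
    and b: "clinear b" and topb: "top_pair b T x y"
    and p: "1 < p" and \<gamma>: "0 < \<gamma>"
    and eq: "schatten_power p a = schatten_power p b"
      "schatten_power p (\<lambda>z. a z + \<gamma> *\<^sub>R rank_one x y z)
        = schatten_power p (\<lambda>z. b z + \<gamma> *\<^sub>R rank_one x y z)"
  shows "T \<le> S"
proof (rule ccontr)
  assume "\<not> T \<le> S"
  have xy: "norm x = 1" "norm y = 1" and S: "0 \<le> S"
    using topa topb by (auto simp: top_pair_def)
  \<comment> \<open>Perturbing at the top pair of \<open>b\<close> gives \<open>b\<close> the full
    gain belonging to \<open>T\<close>, while \<open>a\<close> gains at most the amount belonging to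
    \<open>S\<close>. With \<open>S < T\<close> the two perturbed powers could not agree.\<close>
  have "(S + \<gamma>) powr p - S powr p < (T + \<gamma>) powr p - T powr p"
    using \<open>\<not> T \<le> S\<close> by (intro powr_increment_strict_mono[OF p S _ \<gamma>]) simp
  then show False
    using schatten_power_perturb(1)[OF a topa p \<gamma> xy] schatten_power_perturb_top[OF b topb _ \<gamma>, of p]
      p eq by simp
qed

text \<open>
  The sets \<open>U\<close> and \<open>V\<close> collect the left and right singular vectors that have already been
  split off from both operators.
\<close>

lemma eq_if_schatten_perturbations_eq:
  fixes a b :: "'h \<Rightarrow> 'h"
  assumes p: "1 < p" and \<gamma>: "0 < \<gamma>" and a: "clinear a" and b: "clinear b"
    and U: "\<And>w z. w \<in> U \<Longrightarrow> cinner w (a z) = 0" "\<And>w z. w \<in> U \<Longrightarrow> cinner w (b z) = 0"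
    and V: "\<And>w. w \<in> V \<Longrightarrow> a w = 0" "\<And>w. w \<in> V \<Longrightarrow> b w = 0"
    and eq: "schatten_power p a = schatten_power p b"
    and perturb_eq: "\<And>x y. norm x = 1 \<Longrightarrow> norm y = 1 \<Longrightarrow>
      (\<And>w. w \<in> U \<Longrightarrow> cinner w x = 0) \<Longrightarrow> (\<And>w. w \<in> V \<Longrightarrow> cinner w y = 0) \<Longrightarrow>
      schatten_power p (\<lambda>z. a z + \<gamma> *\<^sub>R rank_one x y z)
        = schatten_power p (\<lambda>z. b z + \<gamma> *\<^sub>R rank_one x y z)"
  shows "a = b"
  using a b U V eq perturb_eq
proof (induction a arbitrary: b U V rule: deflation_induct)
  case zero
  show ?case
  proof (rule ccontr)
    assume "(\<lambda>x. 0) \<noteq> b"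
    then obtain x0 where "b x0 \<noteq> 0" by (metis ext)
    then obtain S u v where "top_pair b S u v" using ex_top_pair[OF zero(1)] by blast
    from schatten_power_pos[OF zero(1) this, of p] show False
      using zero(6) schatten_power_0[of p] p by simp
  qed
next
  case (deflate a S u v b U V)
  note a = deflate(1) and topa = deflate(2) and b = deflate(4)
  note U = deflate(5,6) and V = deflate(7,8) and eq = deflate(9) and perturb_eq = deflate(10)
  have p0: "0 < p" using p by simp
  have "\<exists>x. b x \<noteq> 0"
  proof (rule ccontr)
    assume "\<not> ?thesis"
    then have "b = (\<lambda>x. 0)" by auto
    then show False
      using schatten_power_pos[OF a topa p0] eq schatten_power_0[OF p0] by simp
  qed
  then obtain T u' v' where topb: "top_pair b T u' v'" using ex_top_pair[OF b] by blast
  have uv: "norm u = 1" "norm v = 1" "norm u' = 1" "norm v' = 1" and S: "0 < S"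
    using topa topb by (auto simp: top_pair_def)
  \<comment> \<open>The vectors \<open>u\<close> and \<open>u'\<close> lie in the ranges of
    \<open>a\<close> and \<open>b\<close>, which are orthogonal to \<open>U\<close>. Thus both top
    pairs are admissible in \<open>perturb_eq\<close>.\<close>
  have orth: "cinner w u = 0" "cinner w u' = 0" if "w \<in> U" for w
    using U[OF that, of v] U[OF that, of v'] topa topb
    by (auto simp: top_pair_def cinner_scaleR_right)
  have orth': "cinner w v = 0" "cinner w v' = 0" "cinner v w = 0" if "w \<in> V" for w
    using top_pair_kernel[OF a topa V(1)[OF that]] top_pair_kernel[OF b topb V(2)[OF that]]
    by (auto simp: cinner_eq_zero_commute)
  have eq_uv: "schatten_power p (\<lambda>z. a z + \<gamma> *\<^sub>R rank_one u v z)
      = schatten_power p (\<lambda>z. b z + \<gamma> *\<^sub>R rank_one u v z)"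
    using uv orth orth' by (intro perturb_eq) auto
  have "schatten_power p (\<lambda>z. a z + \<gamma> *\<^sub>R rank_one u' v' z)
      = schatten_power p (\<lambda>z. b z + \<gamma> *\<^sub>R rank_one u' v' z)"
    using uv orth orth' by (intro perturb_eq) auto
  then have "T = S"
    using top_value_le[OF a topa b topb p \<gamma> eq] top_value_le[OF b topb a topa p \<gamma> eq[symmetric]]
      eq_uv by simp
  \<comment> \<open>The pair \<open>(u, v)\<close> has the maximal gain on \<open>a\<close>, hence
    also on \<open>b\<close>, because the powers agree and \<open>T = S\<close>. The equality case
    then makes it a top pair of \<open>b\<close>.\<close>
  have "schatten_power p (\<lambda>z. b z + \<gamma> *\<^sub>R rank_one u v z)
      = schatten_power p b + ((T + \<gamma>) powr p - T powr p)"
    using schatten_power_perturb_top[OF a topa p0 \<gamma>] eq eq_uv \<open>T = S\<close> by simp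
  then have topb': "top_pair b S u v"
    using schatten_power_perturb(2)[OF b topb p \<gamma> uv(1,2)] \<open>T = S\<close> by simp
  \<comment> \<open>A perturbation with \<open>x\<close> orthogonal to \<open>u\<close> and
    \<open>y\<close> orthogonal to \<open>v\<close> does not interact with the piece that was split
    off, so undoing the deflation adds \<open>S powr p\<close> whichever operator \<open>c\<close>
    is.\<close>
  have restore: "schatten_power p (\<lambda>z. c z + \<gamma> *\<^sub>R rank_one x y z)
      = schatten_power p (\<lambda>z. deflate c S u v z + \<gamma> *\<^sub>R rank_one x y z) + S powr p"
    if c: "clinear c" "top_pair c S u v" and x: "cinner u x = 0" and y: "cinner v y = 0"
    for c and x y :: 'h
  proof -
    have "schatten_power p (\<lambda>z. (deflate c S u v z + \<gamma> *\<^sub>R rank_one x y z) + S *\<^sub>R rank_one u v z)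
        = schatten_power p (\<lambda>z. deflate c S u v z + \<gamma> *\<^sub>R rank_one x y z) + S powr p"
    proof (rule schatten_power_add[OF _ p0 uv(1,2) _ _ S])
      show "deflate c S u v v + \<gamma> *\<^sub>R rank_one x y v = 0"
        using y by (simp add: deflate_top[OF c] rank_one_def cinner_eq_zero_commute)
      show "cinner u (deflate c S u v z + \<gamma> *\<^sub>R rank_one x y z) = 0" for z
        using x by (simp add: deflate_top[OF c] rank_one_def cinner_simps)
    qed (intro clinear_perturb clinear_deflate c)
    then show ?thesis by (simp add: deflate_def algebra_simps)
  qed
  \<comment> \<open>All hypotheses pass to the deflations: \<open>u\<close> and \<open>v\<close>
    join the two orthogonality sets, and each equality of powers survives because both sides drop by
    \<open>S powr p\<close>.\<close>
  have "deflate a S u v = deflate b S u v"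
  proof (rule deflate.IH)
    show "clinear (deflate b S u v)" using b by simp
    show "schatten_power p (deflate a S u v) = schatten_power p (deflate b S u v)"
      using schatten_power_deflate[OF a topa p0] schatten_power_deflate[OF b topb' p0] eq by simp
    show "cinner w (deflate a S u v z) = 0" if "w \<in> insert u U" for w z
      using that U(1) orth deflate_top[OF a topa]
      by (auto simp: deflate_def rank_one_def cinner_simps)
    show "cinner w (deflate b S u v z) = 0" if "w \<in> insert u U" for w z
      using that U(2) orth deflate_top[OF b topb']
      by (auto simp: deflate_def rank_one_def cinner_simps)
    show "deflate a S u v w = 0" if "w \<in> insert v V" for w
      using that V(1) orth' deflate_top[OF a topa]
      by (auto simp: deflate_def rank_one_def)
    show "deflate b S u v w = 0" if "w \<in> insert v V" for w
      using that V(2) orth' deflate_top[OF b topb']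
      by (auto simp: deflate_def rank_one_def)
    show "schatten_power p (\<lambda>z. deflate a S u v z + \<gamma> *\<^sub>R rank_one x y z)
        = schatten_power p (\<lambda>z. deflate b S u v z + \<gamma> *\<^sub>R rank_one x y z)"
      if "norm x = 1" "norm y = 1" "\<And>w. w \<in> insert u U \<Longrightarrow> cinner w x = 0"
        "\<And>w. w \<in> insert v V \<Longrightarrow> cinner w y = 0" for x y
      using restore[OF a topa, of x y] restore[OF b topb', of x y] perturb_eq[of x y] that by simp
  qed
  then show ?case by (auto simp: deflate_def fun_eq_iff)
qed

end

theorem proposition2p10:
  fixes p \<gamma> :: real
    and a b :: "'h::complex_hilbert \<Rightarrow> 'h"
  assumes "\<exists>B::'h set. finite B \<and> complex_vector.span B = UNIV"
    and "1 < p" and "p \<noteq> 2" and "1 \<le> \<gamma>"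
    and "a \<in> schatten_sphere p" and "b \<in> schatten_sphere p"
    and "\<forall>e\<in>min_partial_isometries.
      schatten_norm p (\<lambda>x. a x - \<gamma> *\<^sub>R e x) = schatten_norm p (\<lambda>x. b x - \<gamma> *\<^sub>R e x)"
  shows "a = b"
proof -
  obtain B :: "'h set" where "finite B" "complex_vector.span B = UNIV" using assms(1) by blast
  then interpret finite_dim_hilbert B by unfold_locales
  show ?thesis
  proof (rule eq_if_schatten_perturbations_eq[where U = "{}" and V = "{}" and \<gamma> = \<gamma> and p = p])
    show "schatten_power p (\<lambda>z. a z + \<gamma> *\<^sub>R rank_one x y z)
        = schatten_power p (\<lambda>z. b z + \<gamma> *\<^sub>R rank_one x y z)"
      if "norm x = 1" "norm y = 1" for x y
    proof -
      \<comment> \<open>The minus sign in the hypothesis is absorbed into the unit vector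
        \<open>x\<close>.\<close>
      have "rank_one (- x) y \<in> min_partial_isometries"
        using that by (intro rank_one_min_partial_isometry) auto
      moreover have "rank_one (- x) y z = - rank_one x y z" for z
        by (simp add: rank_one_def)
      ultimately show ?thesis
        using assms(7) by (force simp: schatten_power_def)
    qed
  qed (use assms in \<open>auto simp: schatten_sphere_def schatten_power_def\<close>)
qed

end
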